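(* Let $G$ be a connected graph with $n$ nodes, $m$ edges and incidence matrix $B$. Consider the network $$\dot x=f(x)+B\lambda+Pw,\qquad z=B^Tx, \tag{N}$$ with $f(x)=(f_1(x_1),\dots,f_n(x_n))^T$, input $\lambda$ and output $z$, and the edge systems $$\dot\eta_k=\phi_k(\eta_k,v_k),\quad u_k=\psi_k(\eta_k),\qquad k=1,\dots,n-1,$$ collected as $$\dot\eta=\Phi(\eta,v),\qquad u=\Psi(\eta), \tag{E}$$ with $\eta=(\eta_1^T,\dots,\eta_{n-1}^T)^T$, $\Phi=(\phi_1^T,\dots,\phi_{n-1}^T)^T$, $\Psi=(\psi_1,\dots,\psi_{n-1},\mathbf 0^T)^T$ (so $u_k=0$ for $k=n,\dots,m$), input $v\in\mathbb R^m$ and output $u\in\mathbb R^m$. Suppose: (A) For each $i=1,\dots,n$ there is a regular storage function $V_i:\mathbb R\times\mathbb R\times\mathbb R_+\to\mathbb R_+$, $V_i=V_i(x_i,x_i',t)$, such that $$\frac{\partial V_i}{\partial t}+\frac{\partial V_i}{\partial x_i}\big(f_i(x_i)+b_i\lambda+p_iw\big)+\frac{\partial V_i}{\partial x_i'}\big(f_i(x_i')+b_i\lambda'+p_iw\big)\le(y_i-y_i')^T(\lambda-\lambda'),$$ where $y_i=b_i^Tx_i$, $y_i'=b_i^Tx_i'$. (B) For each $k=1,\dots,n-1$ there is a regular function $W_k(\eta_k,\eta_k')$ such that, with $u_k=\psi_k(\eta_k)$ and $u_k'=\psi_k(\eta_k')$, $$\frac{\partial W_k}{\partial\eta_k}\phi_k(\eta_k,v_k)+\frac{\partial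 W_k}{\partial\eta_k'}\phi_k(\eta_k',v_k')\le(u_k-u_k')(v_k-v_k').$$ (C) For each solution $w$ of $\dot w=S^dw$ there exist a function $\lambda^w:\mathbb R_+\to\mathbb R^m$ with $\lambda^w_k\equiv0$ for $k=n,\dots,m$, and continuously differentiable functions $x^w_i:\mathbb R_+\to\mathbb R$, $i=1,\dots,n$, such that $\dot x^w_i=f_i(x^w_i)+b_i\lambda^w+p_iw$ for all $i$ and $\sum_{i=1}^nb_i^Tx^w_i=\mathbf 0$ (so that, by connectivity, all the $x^w_i$ equal a common function $x^w_\ast$), and $x^w_\ast$ is bounded. (D) For each $k=1,\dots,n-1$ and each solution $w$ of $\dot w=S^dw$ there is a bounded solution $\eta_k^w$ of $\dot\eta_k=\phi_k(\eta_k,0)$ such that $\lambda^w_k=\psi_k(\eta^w_k)$. Interconnect (N) and (E) via $$v=-z+v_{ext},\qquad\lambda=u+\lambda_{ext}.$$ Then the interconnected system is incrementally passive from the input $(\lambda_{ext}^T\ v_{ext}^T)^T$ to the output $(z^T\ u^T)^T$. Moreover, the feedback $\lambda_{ext}=-Kz$, $v_{ext}=\mathbf 0$, with $K$ a positive definite diagonal matrix, guarantees $\lim_{t\to+\infty}z(t)=\mathbf 0$.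
   Context: Incidence matrix: $G$ is an undirected graph, the two ends of each edge labeled $+$ and $-$; $B\in\mathbb R^{n\times m}$ has entries $b_{ik}=+1$ if node $i$ is the positive end of edge $k$, $-1$ if it is the negative end, $0$ otherwise. The edges are labeled so that the first $n-1$ columns of $B$ are linearly independent. $b_i$ is the $i$-th row of $B$ and $p_i$ the $i$-th row of a given matrix $P\in\mathbb R^{n\times p}$. The exogenous signal $w:\mathbb R_+\to\mathbb R^p$ solves $\dot w=S^dw$, with $S^d\in\mathbb R^{p\times p}$ a given matrix. $x=(x_1,\dots,x_n)^T\in\mathbb R^n$, $\lambda\in\mathbb R^m$, $f_i:\mathbb R\to\mathbb R$. The edge state $\eta_k$ lives in some finite-dimensional real space and $v_k,u_k\in\mathbb R$. A storage function $V(\xi,\xi',t)$ is a nonnegative continuously differentiable function; it is regular if for every sequence $(\xi^j,\xi'^j,t^j)$ with $\xi'^j$ bounded, $t^j\to+\infty$ and $|\xi^j|\to+\infty$ one has $V(\xi^j,\xi'^j,t^j)\to+\infty$ (for a time-independent function $V(\xi,\xi')$, omit $t^j$). Incremental passivity: a system with state $\xi$, input $\mu$, output $y$ (possibly depending on the exogenous signal $w$) is incrementally passive from $\mu$ to $y$ if there is a storage function $U(\xi,\xi',t)$ such that, for any two inputs $\mu,\mu'$ and any corresponding solutions $\xi,\xi'$ (with the same $w$) with outputs $y,y'$, one has $\frac{d}{dt}U(\xi(t),\xi'(t),t)\le(y-y')^T(\mu-\mu')$. *)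

theory Defs
  imports "HOL-Analysis.Analysis" "Graph_Theory.Digraph_Component"
begin

text \<open>
  A signed labeling of the two ends of every edge is an arbitrary orientation, so an undirected graph
  with labeled ends is a \<^typ>\<open>('n, 'm) pre_digraph\<close>, the head of an arc being its positive end and
  the tail its negative end; connectedness (of the underlying undirected graph) is then
  \<^const>\<open>Digraph_Component.connected\<close>.
\<close>

definition incidence_matrix :: "('n::finite, 'm::finite) pre_digraph \<Rightarrow> real^'m^'n" where
  "incidence_matrix G =
     (\<chi> i k. if i = head G k then 1 else if i = tail G k then -1 else 0)"

text \<open>
  The sets \<open>S\<close> used below are products of linear subspaces and half-lines \<open>{0..}\<close>, hence convex. At
  points of \<open>S\<close> the derivative within \<open>S\<close> is uniquely determined in the directions tangent to \<open>S\<close>; at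
  time \<open>0\<close> the time derivative is the one-sided one.
\<close>

definition C1_on :: "'a::euclidean_space set \<Rightarrow> ('a \<Rightarrow> real) \<Rightarrow> bool" where
  "C1_on S f \<longleftrightarrow>
     (\<exists>D :: 'a \<Rightarrow> 'a \<Rightarrow>\<^sub>L real. continuous_on S D \<and>
        (\<forall>x\<in>S. (f has_derivative blinfun_apply (D x)) (at x within S)))"

definition storage_function :: "'a::euclidean_space set \<Rightarrow> ('a \<Rightarrow> 'a \<Rightarrow> real \<Rightarrow> real) \<Rightarrow> bool" where
  "storage_function X V \<longleftrightarrow>
     (\<forall>\<xi>\<in>X. \<forall>\<xi>'\<in>X. \<forall>t\<ge>0. V \<xi> \<xi>' t \<ge> 0) \<and>
     C1_on (X \<times> X \<times> {0..}) (\<lambda>(\<xi>, \<xi>', t). V \<xi> \<xi>' t)"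

definition regular_storage_function ::
    "'a::euclidean_space set \<Rightarrow> ('a \<Rightarrow> 'a \<Rightarrow> real \<Rightarrow> real) \<Rightarrow> bool" where
  "regular_storage_function X V \<longleftrightarrow>
     storage_function X V \<and>
     (\<forall>\<xi> \<xi>' t.
        (\<forall>j::nat. \<xi> j \<in> X \<and> \<xi>' j \<in> X \<and> t j \<ge> 0) \<and> bounded (range \<xi>') \<and>
        filterlim t at_top sequentially \<and> filterlim (\<lambda>j. norm (\<xi> j)) at_top sequentially \<longrightarrow>
        filterlim (\<lambda>j. V (\<xi> j) (\<xi>' j) (t j)) at_top sequentially)"

definition solution ::
    "'a::real_normed_vector set \<Rightarrow> (real \<Rightarrow> 'a \<Rightarrow> 'a) \<Rightarrow> (real \<Rightarrow> 'a) \<Rightarrow> bool" where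
  "solution X F \<xi> \<longleftrightarrow>
     (\<forall>t\<ge>0. \<xi> t \<in> X \<and> (\<xi> has_vector_derivative F t (\<xi> t)) (at t within {0..}))"

text \<open>
  A system has state space \<open>X\<close>, dynamics \<open>F\<close> (state, input, exogenous value) and output \<open>H\<close> (state,
  exogenous value); \<open>\<W>\<close> is the set of exogenous signals. The storage function is not allowed to depend
  on the exogenous signal.
\<close>

definition incrementally_passive ::
    "'s::euclidean_space set \<Rightarrow> (real \<Rightarrow> 'w) set \<Rightarrow> ('s \<Rightarrow> 'i \<Rightarrow> 'w \<Rightarrow> 's) \<Rightarrow>
     ('s \<Rightarrow> 'w \<Rightarrow> 'i::real_inner) \<Rightarrow> bool" where
  "incrementally_passive X \<W> F H \<longleftrightarrow>
     (\<exists>U. storage_function X U \<and>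
        (\<forall>w\<in>\<W>. \<forall>\<mu> \<mu>' \<xi> \<xi>'.
           solution X (\<lambda>t s. F s (\<mu> t) (w t)) \<xi> \<and>
           solution X (\<lambda>t s. F s (\<mu>' t) (w t)) \<xi>' \<longrightarrow>
           (\<forall>t\<ge>0. \<exists>d. ((\<lambda>t. U (\<xi> t) (\<xi>' t) t) has_real_derivative d) (at t within {0..}) \<and>
                     d \<le> (H (\<xi> t) (w t) - H (\<xi>' t) (w t)) \<bullet> (\<mu> t - \<mu>' t))))"

definition network_dynamics ::
    "('n \<Rightarrow> real \<Rightarrow> real) \<Rightarrow> real^'m^'n \<Rightarrow> real^'p^'n \<Rightarrow>
     real^'n \<Rightarrow> real^'m \<Rightarrow> real^'p \<Rightarrow> real^'n" where
  "network_dynamics f B P x l w = (\<chi> i. f i (x $ i)) + B *v l + P *v w"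

definition network_output :: "real^'m^'n \<Rightarrow> real^'n \<Rightarrow> real^'m" where
  "network_output B x = transpose B *v x"

text \<open>
  Only the edges in \<open>T\<close> carry dynamics. The state of edge \<open>k\<close> lives in the subspace \<open>Q k\<close> of a Euclidean
  space common to all edges, so that the state spaces of different edges may have different dimensions;
  the components of the stacked state at the remaining edges are identically zero.
\<close>

definition edge_state_space :: "'m set \<Rightarrow> ('m \<Rightarrow> 'e::zero set) \<Rightarrow> ('e^'m) set" where
  "edge_state_space T Q = {\<eta>. \<forall>k. (k \<in> T \<longrightarrow> \<eta> $ k \<in> Q k) \<and> (k \<notin> T \<longrightarrow> \<eta> $ k = 0)}"

definition edge_dynamics ::
    "'m set \<Rightarrow> ('m \<Rightarrow> 'e::zero \<Rightarrow> real \<Rightarrow> 'e) \<Rightarrow> 'e^'m \<Rightarrow> real^'m \<Rightarrow> 'e^'m" where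
  "edge_dynamics T \<phi> \<eta> v = (\<chi> k. if k \<in> T then \<phi> k (\<eta> $ k) (v $ k) else 0)"

definition edge_output :: "'m set \<Rightarrow> ('m \<Rightarrow> 'e \<Rightarrow> real) \<Rightarrow> 'e^'m \<Rightarrow> real^'m" where
  "edge_output T \<psi> \<eta> = (\<chi> k. if k \<in> T then \<psi> k (\<eta> $ k) else 0)"

definition interconnected_dynamics ::
    "('n \<Rightarrow> real \<Rightarrow> real) \<Rightarrow> real^'m^'n \<Rightarrow> real^'p^'n \<Rightarrow> 'm set \<Rightarrow>
     ('m \<Rightarrow> 'e::zero \<Rightarrow> real \<Rightarrow> 'e) \<Rightarrow> ('m \<Rightarrow> 'e \<Rightarrow> real) \<Rightarrow>
     (real^'n) \<times> ('e^'m) \<Rightarrow> (real^'m) \<times> (real^'m) \<Rightarrow> real^'p \<Rightarrow> (real^'n) \<times> ('e^'m)" where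
  "interconnected_dynamics f B P T \<phi> \<psi> = (\<lambda>(x, \<eta>) (l_ext, v_ext) w.
     (let z = network_output B x; u = edge_output T \<psi> \<eta>; v = - z + v_ext; l = u + l_ext
      in (network_dynamics f B P x l w, edge_dynamics T \<phi> \<eta> v)))"

definition interconnected_output ::
    "real^'m^'n \<Rightarrow> 'm set \<Rightarrow> ('m \<Rightarrow> 'e \<Rightarrow> real) \<Rightarrow>
     (real^'n) \<times> ('e^'m) \<Rightarrow> (real^'m) \<times> (real^'m)" where
  "interconnected_output B T \<psi> = (\<lambda>(x, \<eta>). (network_output B x, edge_output T \<psi> \<eta>))"

end

theory Submission
  imports Defs
begin

text \<open>
  The inputs in the node inequality are arbitrary, so it forces \<open>\<partial>V\<^sub>i/\<partial>x\<^sub>i = x\<^sub>i - x\<^sub>i'\<close> and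
  \<open>\<partial>V\<^sub>i/\<partial>x\<^sub>i' = x\<^sub>i' - x\<^sub>i\<close>; the rest of the inequality then bounds the rate of change of \<open>V\<^sub>i\<close> in
  time, and \<open>V\<^sub>i \<ge> 0\<close> leaves only the possibility that \<open>f\<^sub>i\<close> is nonincreasing. Hence
  \<open>U = \<bar>x - x'\<bar>\<^sup>2 / 2 + \<Sum>\<^sub>k W\<^sub>k(\<eta>\<^sub>k, \<eta>\<^sub>k')\<close> is a storage function of the interconnection.

  The reference \<open>(x\<^sup>w, \<eta>\<^sup>w)\<close> is a bounded trajectory of the interconnection for zero external input,
  with zero \<open>z\<close>. Along the closed loop \<open>U\<close> decreases at rate at least \<open>\<kappa> \<bar>z\<bar>\<^sup>2\<close>, so \<open>x\<close> and \<open>\<eta>\<close> are bounded.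
  If the velocity of \<open>x - x\<^sup>w\<close> is bounded as well, \<open>z\<close> is Lipschitz and tends to \<open>0\<close>. The exogenous
  signal, possibly unbounded, cancels from that velocity, and \<open>f\<^sub>i\<close>, being monotone, is bounded on
  bounded sets. The functions \<open>\<psi>\<^sub>k\<close> are not assumed continuous, but the edge inequality makes them
  bounded on bounded sets too.
\<close>

section \<open>Continuously differentiable functions and regular storage functions\<close>

text \<open>A derivative within \<open>Q\<close> is a map on the whole space, but \<open>Q\<close>
  determines only its values on \<open>Q\<close>. Those are read off from the line
  \<open>x + t *\<^sub>R h\<close>, which stays in \<open>Q\<close> and along which the derivative
  is two-sided.\<close>

lemma has_derivative_within_subspace_unique:
  fixes f :: "'a::real_normed_vector \<Rightarrow> 'b::real_normed_vector"
  assumes Q: "subspace Q" "x \<in> Q" "h \<in> Q"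
    and D: "(f has_derivative D) (at x within Q)" and E: "(f has_derivative E) (at x within Q)"
  shows "D h = E h"
proof -
  have line: "((\<lambda>t. f (x + t *\<^sub>R h)) has_derivative (\<lambda>t. F (t *\<^sub>R h))) (at 0)"
    if F: "(f has_derivative F) (at x within Q)" for F
  proof -
    have "((\<lambda>t. x + t *\<^sub>R h) has_derivative (\<lambda>t. t *\<^sub>R h)) (at 0)"
      by (auto intro!: derivative_eq_intros)
    moreover have "(f has_derivative F) (at (x + 0 *\<^sub>R h) within range (\<lambda>t. x + t *\<^sub>R h))"
      using Q by (auto intro!: has_derivative_subset[OF F] subspace_add subspace_scale)
    ultimately show ?thesis
      using diff_chain_within[of "\<lambda>t. x + t *\<^sub>R h" _ 0 UNIV f F] by (simp add: o_def)
  qed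
  from has_derivative_unique[OF line[OF D] line[OF E]] have "(\<lambda>t. D (t *\<^sub>R h)) = (\<lambda>t. E (t *\<^sub>R h))" .
  from fun_cong[OF this, of 1] show ?thesis by simp
qed

text \<open>\<open>frechet_derivative\<close> picks one of possibly many derivatives within
  \<open>Q\<close>; in directions of \<open>Q\<close> the choice is immaterial. This turns the edge
  inequality, stated with \<open>frechet_derivative\<close>, into one for a continuous
  derivative.\<close>

lemma frechet_derivative_within_subspace:
  fixes f :: "'a::real_normed_vector \<Rightarrow> 'b::real_normed_vector"
  assumes "subspace Q" "x \<in> Q" "h \<in> Q" "(f has_derivative D) (at x within Q)"
  shows "frechet_derivative f (at x within Q) h = D h"
  using assms has_derivative_within_subspace_unique frechet_derivative_works differentiableI by metis

lemma C1_on_compose_linear: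
  assumes g: "bounded_linear g" "g ` S \<subseteq> S'" and f: "C1_on S' f"
  shows "C1_on S (\<lambda>x. f (g x))"
proof -
  obtain D where D: "continuous_on S' D" "\<And>x. x \<in> S' \<Longrightarrow> (f has_derivative blinfun_apply (D x)) (at x within S')"
    using f unfolding C1_on_def by blast
  have "(f \<circ> g has_derivative blinfun_apply (D (g x)) \<circ> g) (at x within S)" if "x \<in> S" for x
    using that g(2) D(2) by (intro diff_chain_within bounded_linear_imp_has_derivative g(1) has_derivative_subset[OF D(2)]) auto
  moreover have "continuous_on S (\<lambda>x. D (g x) o\<^sub>L Blinfun g)"
    using g by (intro continuous_intros continuous_on_compose2[OF D(1)] linear_continuous_on) auto
  ultimately show ?thesis
    unfolding C1_on_def
    by (intro exI[of _ "\<lambda>x. D (g x) o\<^sub>L Blinfun g"])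
      (auto simp: blinfun_compose.rep_eq bounded_linear_Blinfun_apply[OF g(1)] o_def)
qed

lemma C1_on_zero: "C1_on S (\<lambda>_. 0)"
  unfolding C1_on_def by (rule exI[of _ "\<lambda>_. 0"]) (auto simp: zero_blinfun.rep_eq)

lemma C1_on_add:
  assumes "C1_on S f" "C1_on S g"
  shows "C1_on S (\<lambda>x. f x + g x)"
proof -
  obtain D E where "continuous_on S D" "\<And>x. x \<in> S \<Longrightarrow> (f has_derivative blinfun_apply (D x)) (at x within S)"
    "continuous_on S E" "\<And>x. x \<in> S \<Longrightarrow> (g has_derivative blinfun_apply (E x)) (at x within S)"
    using assms unfolding C1_on_def by blast
  then show ?thesis
    unfolding C1_on_def
    by (intro exI[of _ "\<lambda>x. D x + E x"])
      (auto intro!: continuous_intros derivative_eq_intros simp: blinfun.add_left)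
qed

lemma C1_on_sum: "(\<And>i. i \<in> I \<Longrightarrow> C1_on S (f i)) \<Longrightarrow> C1_on S (\<lambda>x. \<Sum>i\<in>I. f i x)"
  by (induction I rule: infinite_finite_induct) (auto simp: C1_on_zero C1_on_add)

lemma C1_on_half_norm_square:
  fixes h :: "'a::euclidean_space \<Rightarrow> 'b::euclidean_space"
  assumes "bounded_linear h"
  shows "C1_on S (\<lambda>x. (h x \<bullet> h x) / 2)"
proof -
  have "((\<lambda>x. (h x \<bullet> h x) / 2) has_derivative blinfun_apply (blinfun_inner_right (h x) o\<^sub>L Blinfun h)) (at x within S)" for x
    by (rule has_derivative_eq_rhs, (rule derivative_eq_intros bounded_linear_imp_has_derivative[OF assms] refl)+)
      (auto simp: bounded_linear_Blinfun_apply[OF assms] inner_commute)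
  moreover have "continuous_on S (\<lambda>x. blinfun_inner_right (h x) o\<^sub>L Blinfun h)"
    using assms by (intro continuous_intros linear_continuous_on)
  ultimately show ?thesis unfolding C1_on_def by blast
qed

text \<open>Violating pairs with \<open>norm (e n) > real n\<close>, taken at the times
  \<open>n\<close>, would contradict regularity. One radius serves all of \<open>S\<close> because
  regularity lets the second argument vary within a bounded set.\<close>

lemma regular_sublevel_bounded:
  assumes reg: "regular_storage_function Q (\<lambda>e e' _. W e e')" and S: "S \<subseteq> Q" "bounded S"
  shows "\<exists>R. \<forall>e\<in>Q. \<forall>e'\<in>S. W e e' \<le> c \<longrightarrow> norm e \<le> R"
proof (rule ccontr)
  assume "\<not> ?thesis"
  then have "\<exists>e e'. e \<in> Q \<and> e' \<in> S \<and> W e e' \<le> c \<and> norm e > real n" for n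
    by (metis not_le)
  then obtain e e' where e: "\<And>n. e n \<in> Q" "\<And>n. e' n \<in> S" "\<And>n. W (e n) (e' n) \<le> c" "\<And>n. norm (e n) > real n"
    by metis
  have "filterlim (\<lambda>n. W (e n) (e' n)) at_top sequentially"
  proof (rule reg[unfolded regular_storage_function_def, THEN conjunct2, rule_format, of e e' real])
    have "bounded (range e')" using e(2) by (intro bounded_subset[OF S(2)]) auto
    moreover have "filterlim (\<lambda>n. norm (e n)) at_top sequentially"
      by (rule filterlim_at_top_mono[OF filterlim_real_sequentially])
        (use e(4) in \<open>auto intro: less_imp_le eventuallyI\<close>)
    ultimately show "(\<forall>j. e j \<in> Q \<and> e' j \<in> Q \<and> 0 \<le> real j) \<and> bounded (range e') \<and>
        filterlim real at_top sequentially \<and> filterlim (\<lambda>j. norm (e j)) at_top sequentially"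
      using e(1,2) S(1) by (auto simp: filterlim_real_sequentially)
  qed
  then have "\<forall>\<^sub>F n in sequentially. W (e n) (e' n) > c"
    by (auto simp: filterlim_at_top_dense)
  then show False using e(3) by (auto simp: eventually_sequentially not_less[symmetric])
qed

text \<open>\<open>adjoint l 1\<close> represents \<open>l\<close> on the whole space; its component
  orthogonal to \<open>Q\<close> does not act on \<open>Q\<close>, so its projection is the gradient
  within \<open>Q\<close>.\<close>

lemma riesz_subspace:
  fixes l :: "'e::euclidean_space \<Rightarrow> real"
  assumes "linear l" "subspace Q"
  shows "\<exists>a\<in>Q. \<forall>h\<in>Q. a \<bullet> h = l h"
proof -
  obtain y z where yz: "y \<in> span Q" "\<And>w. w \<in> span Q \<Longrightarrow> orthogonal z w" "adjoint l 1 = y + z"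
    using orthogonal_subspace_decomp_exists by blast
  have "y \<bullet> h = l h" if "h \<in> Q" for h
    using yz(2)[of h] yz(3) that adjoint_works[OF assms(1), of h 1]
    by (simp add: inner_commute[of h] inner_add_left orthogonal_def span_base)
  moreover have "y \<in> Q" using yz(1) span_eq_iff assms(2) by blast
  ultimately show ?thesis by blast
qed

section \<open>Boundedness of the edge outputs\<close>

text \<open>A direction \<open>l\<close> in the span with \<open>a j \<bullet> l \<le> 0\<close> for
  all \<open>j\<close> must be zero, since the weighted sum vanishes there. Hence the part of
  \<open>p v\<close> seen by the \<open>a j\<close> grows at most linearly in \<open>v\<close>, and
  \<open>a j \<bullet> p v\<close> is bounded below with a slope in \<open>\<bar>v\<bar>\<close>
  common to all \<open>j\<close>. Then \<open>\<bar>\<gamma> j\<bar>\<close> cannot exceed that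
  slope, however large \<open>C j\<close> is.\<close>

lemma gradient_bound_of_vanishing_mean:
  fixes a :: "nat \<Rightarrow> 'e::euclidean_space" and p :: "real \<Rightarrow> 'e" and c \<gamma> C :: "nat \<Rightarrow> real"
  assumes c: "\<And>j. c j > 0"
    and mean: "\<And>h. h \<in> span (range a) \<Longrightarrow> (\<lambda>j. c j * (a j \<bullet> h)) sums 0"
    and bd: "bounded (range a)"
    and le: "\<And>j v. a j \<bullet> p v \<le> \<gamma> j * v + C j"
  shows "bounded (range \<gamma>)"
proof -
  \<comment> \<open>Only the projection \<open>q v\<close> of \<open>p v\<close> onto the span
    enters the products \<open>a j \<bullet> p v\<close>.\<close>
  have "\<exists>q. q \<in> span (range a) \<and> (\<forall>x\<in>span (range a). x \<bullet> (p v - q) = 0)" for v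
  proof -
    obtain y z where "y \<in> span (range a)" "\<And>w. w \<in> span (range a) \<Longrightarrow> orthogonal z w" "p v = y + z"
      using orthogonal_subspace_decomp_exists by blast
    then show ?thesis
      by (intro exI[of _ y]) (auto simp: orthogonal_def inner_commute)
  qed
  then obtain q where q: "\<And>v. q v \<in> span (range a)"
    and qp: "\<And>v x. x \<in> span (range a) \<Longrightarrow> x \<bullet> (p v - q v) = 0" by metis
  have le': "a j \<bullet> q v \<le> \<gamma> j * v + C j" for j v
    using le[of j v] qp[of "a j" v] by (simp add: span_base inner_diff_right)
  \<comment> \<open>Linear growth by compactness: if it failed, the normalised vectors
    \<open>q (v n)\<close> would accumulate at a unit vector \<open>l\<close> of the span.\<close>
  have "\<exists>R. \<forall>v. norm (q v) \<le> R * (1 + \<bar>v\<bar>)"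
  proof (rule ccontr)
    assume "\<not> ?thesis"
    then have "\<exists>v. norm (q v) > real (Suc n) * (1 + \<bar>v\<bar>)" for n
      by (metis not_le)
    then obtain v where v: "\<And>n. norm (q (v n)) > real (Suc n) * (1 + \<bar>v n\<bar>)" by metis
    define u where "u n = q (v n) /\<^sub>R norm (q (v n))" for n
    have pos: "norm (q (v n)) > 0" for n
      using v[of n] by (rule le_less_trans[rotated]) auto
    have u: "u n \<in> sphere 0 1 \<inter> span (range a)" for n
      using pos[of n] q by (auto simp: u_def intro: span_mul)
    have "compact (sphere 0 1 \<inter> span (range a))"
      by (intro compact_Int_closed compact_sphere closed_subspace subspace_span)
    then obtain l r where l: "l \<in> sphere 0 1 \<inter> span (range a)" and r: "strict_mono r"
      and lim: "(u \<circ> r) \<longlonglongrightarrow> l"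
      using u unfolding compact_def by metis
    have bound: "a j \<bullet> u n \<le> (\<bar>\<gamma> j\<bar> + \<bar>C j\<bar>) * inverse (real (Suc n))" for j n
    proof -
      have "a j \<bullet> q (v n) \<le> \<bar>\<gamma> j\<bar> * \<bar>v n\<bar> + \<bar>C j\<bar>"
        using le'[of j "v n"] abs_ge_self[of "\<gamma> j * v n"] abs_ge_self[of "C j"] by (simp add: abs_mult)
      also have "\<dots> \<le> (\<bar>\<gamma> j\<bar> + \<bar>C j\<bar>) * (1 + \<bar>v n\<bar>)"
        by (simp add: algebra_simps)
      also have "\<dots> \<le> (\<bar>\<gamma> j\<bar> + \<bar>C j\<bar>) * (norm (q (v n)) * inverse (real (Suc n)))"
        using v[of n] by (intro mult_left_mono) (auto simp: field_simps)
      finally show ?thesis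
        using pos[of n] by (simp add: u_def field_simps)
    qed
    \<comment> \<open>The norm divided by exceeds \<open>Suc n\<close> times
      \<open>1 + \<bar>v n\<bar>\<close>, so the right-hand side of \<open>bound\<close> vanishes in
      the limit.\<close>
    have "a j \<bullet> l \<le> 0" for j
    proof (rule tendsto_le[OF sequentially_bot])
      show "(\<lambda>n. (\<bar>\<gamma> j\<bar> + \<bar>C j\<bar>) * inverse (real (Suc (r n)))) \<longlonglongrightarrow> 0"
        using LIMSEQ_subseq_LIMSEQ[OF tendsto_mult_right_zero[OF LIMSEQ_inverse_real_of_nat] r]
        by (simp add: o_def)
      show "(\<lambda>n. a j \<bullet> u (r n)) \<longlonglongrightarrow> a j \<bullet> l"
        using lim by (auto intro!: tendsto_intros simp: o_def)
    qed (use bound in auto)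
    moreover have s: "(\<lambda>j. - (c j * (a j \<bullet> l))) sums 0"
      using sums_minus[OF mean[of l]] l by simp
    \<comment> \<open>The terms are nonnegative and sum to zero, so every \<open>a j\<close> is
      orthogonal to \<open>l\<close>, which lies in their span.\<close>
    ultimately have "\<forall>j. - (c j * (a j \<bullet> l)) = 0"
      using suminf_eq_zero_iff[OF sums_summable[OF s]] sums_unique[OF s] c
      by (metis (no_types, lifting) less_imp_le mult_nonneg_nonpos neg_0_le_iff_le)
    then have "orthogonal l (a j)" for j
      using c[of j] by (auto simp: orthogonal_def inner_commute dest: spec[of _ j])
    then have "orthogonal l l"
      using orthogonal_to_span[of l "range a" l] l by auto
    with l show False by (simp add: orthogonal_def)
  qed
  then obtain R where R: "\<And>v. norm (q v) \<le> R * (1 + \<bar>v\<bar>)" by blast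
  obtain M where M: "\<And>j. norm (a j) \<le> M" and "M > 0"
    using bd unfolding bounded_pos by auto
  have "R \<ge> 0" using order_trans[OF norm_ge_zero R[of 0]] by simp
  have low: "- (M * R * (1 + \<bar>v\<bar>)) \<le> \<gamma> j * v + C j" for j v
  proof -
    have "\<bar>a j \<bullet> q v\<bar> \<le> norm (a j) * norm (q v)" by (rule Cauchy_Schwarz_ineq2)
    also have "\<dots> \<le> M * (R * (1 + \<bar>v\<bar>))"
      using M R \<open>M > 0\<close> by (intro mult_mono) auto
    finally show ?thesis using le'[of j v] by (simp add: mult.assoc)
  qed
  have "\<bar>\<gamma> j\<bar> \<le> M * R" for j
  proof (rule ccontr)
    define d where "d = \<bar>\<gamma> j\<bar> - M * R"
    assume "\<not> ?thesis"
    then have d: "d > 0" by (simp add: d_def)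
    \<comment> \<open>\<open>x\<close> is so large that the excess slope \<open>d\<close> outweighs
      the constants by 1; \<open>y\<close> gets the sign opposite to \<open>\<gamma> j\<close>, so
      that \<open>low\<close> fails at \<open>y\<close>.\<close>
    define x where "x = (M * R + \<bar>C j\<bar> + 1) / d"
    have x: "d * x = M * R + \<bar>C j\<bar> + 1" "x \<ge> 0"
      using d \<open>M > 0\<close> \<open>R \<ge> 0\<close> by (auto simp: x_def)
    define y where "y = (if \<gamma> j < 0 then x else - x)"
    have "\<gamma> j * y = - \<bar>\<gamma> j\<bar> * x" "\<bar>y\<bar> = x"
      using x(2) by (auto simp: y_def)
    then have "\<bar>\<gamma> j\<bar> * x - M * R * x \<le> M * R + C j"
      using low[of y j] by (simp add: algebra_simps)
    with x(1) show False by (simp add: d_def algebra_simps)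
  qed
  then show ?thesis by (auto simp: bounded_iff)
qed

text \<open>
  If \<open>\<psi>\<close> were unbounded along a sequence \<open>s\<^sub>j\<close> in \<open>S\<close>, take a minimiser \<open>e\<^sub>0\<close> of the coercive function
  \<open>\<Sum>\<^sub>j 2\<^sup>-\<^sup>j W(e, s\<^sub>j)\<close>. The gradients of the functions \<open>W(\<cdot>, s\<^sub>j)\<close> at \<open>e\<^sub>0\<close> have vanishing weighted sum, while
  the inequality bounds each of them in the direction \<open>\<phi>(e\<^sub>0, v)\<close> by \<open>(\<psi>(e\<^sub>0) - \<psi>(s\<^sub>j)) v\<close> plus a constant,
  for every \<open>v\<close>.
\<close>

lemma bounded_edge_output:
  fixes Q :: "'e::euclidean_space set" and D :: "'e \<times> 'e \<Rightarrow> ('e \<times> 'e) \<Rightarrow>\<^sub>L real"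
    and \<psi> :: "'e \<Rightarrow> real"
  assumes Q: "subspace Q"
    and cont: "continuous_on (Q \<times> Q) D"
    and der: "\<And>p. p \<in> Q \<times> Q \<Longrightarrow> ((\<lambda>(e, e'). W e e') has_derivative blinfun_apply (D p)) (at p within Q \<times> Q)"
    and reg: "regular_storage_function Q (\<lambda>e e' _. W e e')"
    and \<phi>: "\<And>e v. e \<in> Q \<Longrightarrow> \<phi> e v \<in> Q"
    and ineq: "\<And>e e' v v'. e \<in> Q \<Longrightarrow> e' \<in> Q \<Longrightarrow>
      D (e, e') (\<phi> e v, 0) + D (e, e') (0, \<phi> e' v') \<le> (\<psi> e - \<psi> e') * (v - v')"
    and S: "S \<subseteq> Q" "bounded S"
  shows "bounded (\<psi> ` S)"
proof (rule ccontr)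
  assume "\<not> ?thesis"
  then have "\<exists>e\<in>S. \<bar>\<psi> e\<bar> > real j" for j :: nat
    unfolding bounded_iff by (auto simp: not_le)
  then obtain s where s: "\<And>j. s j \<in> S" and unb: "\<And>j. \<bar>\<psi> (s j)\<bar> > real j" by metis
  have sQ: "s j \<in> Q" for j using s S(1) by blast
  have Wnn: "W e e' \<ge> 0" if "e \<in> Q" "e' \<in> Q" for e e'
    using reg that unfolding regular_storage_function_def storage_function_def by (auto dest: spec[of _ 0])
  have Wcont: "continuous_on (Q \<times> Q) (\<lambda>(e, e'). W e e')"
    using der by (rule has_derivative_continuous_on)
  \<comment> \<open>The closure is compact and stays inside the closed \<open>Q\<close>, which makes
    the bounds on \<open>W\<close> and its derivative uniform in \<open>j\<close>.\<close>
  define L where "L = closure S"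
  have L: "compact L" "L \<subseteq> Q" "\<And>j. s j \<in> L"
    using S(2) closure_minimal[OF S(1) closed_subspace[OF Q]] subsetD[OF closure_subset s]
    by (auto simp: L_def)
  define c where "c j = (1 / 2 :: real) ^ j" for j :: nat
  have c: "c j > 0" "\<bar>c j\<bar> = c j" "summable c" for j by (auto simp: c_def[abs_def] summable_geometric)
  define \<Psi> where "\<Psi> e = (\<Sum>j. c j * W e (s j))" for e
  have dom: "\<exists>M. \<forall>e \<in> cball 0 R \<inter> Q. \<forall>j. \<bar>W e (s j)\<bar> \<le> M \<and> norm (D (e, s j)) \<le> M" for R
  proof -
    have K: "compact ((cball 0 R \<inter> Q) \<times> L)" "(cball 0 R \<inter> Q) \<times> L \<subseteq> Q \<times> Q"
      using L closed_subspace[OF Q] by (auto intro!: compact_Times compact_Int_closed)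
    obtain M1 where M1: "\<And>p. p \<in> (cball 0 R \<inter> Q) \<times> L \<Longrightarrow> \<bar>(\<lambda>(e, e'). W e e') p\<bar> \<le> M1"
      using compact_imp_bounded[OF compact_continuous_image[OF continuous_on_subset[OF Wcont K(2)] K(1)]]
      unfolding bounded_iff by auto
    obtain M2 where M2: "\<And>p. p \<in> (cball 0 R \<inter> Q) \<times> L \<Longrightarrow> norm (D p) \<le> M2"
      using compact_imp_bounded[OF compact_continuous_image[OF continuous_on_subset[OF cont K(2)] K(1)]]
      unfolding bounded_iff by auto
    show ?thesis
    proof (intro exI[of _ "max M1 M2"] ballI allI conjI)
      fix e j assume "e \<in> cball 0 R \<inter> Q"
      then have "(e, s j) \<in> (cball 0 R \<inter> Q) \<times> L" using L(3) by simp
      from M1[OF this] M2[OF this] show "\<bar>W e (s j)\<bar> \<le> max M1 M2" "norm (D (e, s j)) \<le> max M1 M2"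
        by simp_all
    qed
  qed
  have dom': "\<exists>M. \<forall>j. \<bar>W e (s j)\<bar> \<le> M \<and> norm (D (e, s j)) \<le> M" if e: "e \<in> Q" for e
  proof -
    obtain M where "\<forall>e' \<in> cball 0 (norm e) \<inter> Q. \<forall>j. \<bar>W e' (s j)\<bar> \<le> M \<and> norm (D (e', s j)) \<le> M"
      using dom by blast
    moreover have "e \<in> cball 0 (norm e) \<inter> Q" using e by simp
    ultimately show ?thesis by blast
  qed
  have summ: "summable (\<lambda>j. c j * W e (s j))" if e: "e \<in> Q" for e
  proof -
    obtain M where "\<And>j. \<bar>W e (s j)\<bar> \<le> M" using dom'[OF e] by blast
    then show ?thesis
      using c(1) by (intro summable_comparison_test'[OF summable_mult2[OF c(3), of M]])
        (auto simp: abs_mult c(2))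
  qed
  have \<Psi>cont: "continuous_on (cball 0 R \<inter> Q) \<Psi>" for R
  proof -
    obtain M where M: "\<And>e j. e \<in> cball 0 R \<inter> Q \<Longrightarrow> \<bar>W e (s j)\<bar> \<le> M" using dom[of R] by blast
    have "uniform_limit (cball 0 R \<inter> Q) (\<lambda>n e. \<Sum>j<n. c j * W e (s j)) \<Psi> sequentially"
      unfolding \<Psi>_def using M c(1,3)
      by (intro Weierstrass_m_test[where M = "\<lambda>j. c j * M"] summable_mult2)
        (auto simp: abs_mult c(2))
    then show ?thesis
    proof (rule uniform_limit_theorem[rotated])
      show "\<forall>\<^sub>F n in sequentially. continuous_on (cball 0 R \<inter> Q) (\<lambda>e. \<Sum>j<n. c j * W e (s j))"
        using sQ by (intro always_eventually allI continuous_intros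
            continuous_on_compose2[OF Wcont, where f = "\<lambda>e. (e, s _)", simplified]) auto
    qed simp
  qed
  \<comment> \<open>As \<open>c 0 = 1\<close>, \<open>\<Psi>\<close> dominates
    \<open>W e (s 0)\<close>. Outside the radius \<open>R\<close> it therefore exceeds
    \<open>\<Psi> 0\<close>, and a minimiser over the ball is one over all of
    \<open>Q\<close>.\<close>
  obtain R where R: "\<And>e. e \<in> Q \<Longrightarrow> W e (s 0) \<le> \<Psi> 0 \<Longrightarrow> norm e \<le> R"
    using regular_sublevel_bounded[OF reg, of "{s 0}" "\<Psi> 0"] sQ[of 0] by fastforce
  have low: "W e (s 0) \<le> \<Psi> e" if "e \<in> Q" for e
    using sum_le_suminf[OF summ[OF that], of "{0}"] Wnn[OF that sQ] c(1) unfolding \<Psi>_def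
    by (simp add: c_def less_imp_le)
  have R0: "0 \<le> R"
    using R[of 0] low[of 0] subspace_0[OF Q] by simp
  have "\<exists>e0\<in>cball 0 R \<inter> Q. \<forall>e\<in>cball 0 R \<inter> Q. \<Psi> e0 \<le> \<Psi> e"
  proof (intro continuous_attains_inf compact_Int_closed \<Psi>cont)
    have "0 \<in> cball 0 R \<inter> Q" using R0 subspace_0[OF Q] by simp
    then show "cball 0 R \<inter> Q \<noteq> {}" by blast
  qed (auto simp: closed_subspace Q)
  then obtain e0 where e0: "e0 \<in> Q" "norm e0 \<le> R" and min: "\<And>e. e \<in> Q \<Longrightarrow> norm e \<le> R \<Longrightarrow> \<Psi> e0 \<le> \<Psi> e"
    by auto
  have min: "\<Psi> e0 \<le> \<Psi> e" if "e \<in> Q" for e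
  proof (cases "norm e \<le> R")
    case False
    then have "\<Psi> 0 < W e (s 0)" using R[OF that] by force
    moreover have "\<Psi> e0 \<le> \<Psi> 0" using min[of 0] R0 subspace_0[OF Q] by simp
    ultimately show ?thesis using low[OF that] by simp
  qed (use min that in auto)
  \<comment> \<open>The series is differentiated term by term along
    \<open>e0 + t *\<^sub>R h\<close>, \<open>t \<in> I\<close>: its derivatives are dominated by a
    fixed multiple of the \<open>c j\<close>. At the minimiser the derivative of
    \<open>\<Psi>\<close> is zero.\<close>
  have stationary: "(\<lambda>j. c j * D (e0, s j) (h, 0)) sums 0" if h: "h \<in> Q" for h
  proof -
    define I where "I = {-1..1::real}"
    have eQ: "e0 + t *\<^sub>R h \<in> Q" for t using e0 h Q by (simp add: subspace_add subspace_scale)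
    obtain M where M: "\<And>e j. e \<in> cball 0 (norm e0 + norm h) \<inter> Q \<Longrightarrow> norm (D (e, s j)) \<le> M"
      using dom[of "norm e0 + norm h"] by blast
    have inball: "norm (e0 + t *\<^sub>R h) \<le> norm e0 + norm h" if "t \<in> I" for t
      using that norm_triangle_ineq[of e0 "t *\<^sub>R h"] mult_right_mono[of "\<bar>t\<bar>" 1 "norm h"]
      by (simp add: I_def abs_le_iff)
    have 1: "((\<lambda>t. c j * W (e0 + t *\<^sub>R h) (s j)) has_field_derivative
         c j * D (e0 + t *\<^sub>R h, s j) (h, 0)) (at t within I)" for j t
    proof -
      have "((\<lambda>t. (e0 + t *\<^sub>R h, s j)) has_derivative (\<lambda>t. (t *\<^sub>R h, 0))) (at t within I)"
        by (auto intro!: derivative_eq_intros)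
      moreover have "((\<lambda>(e, e'). W e e') has_derivative blinfun_apply (D (e0 + t *\<^sub>R h, s j)))
          (at (e0 + t *\<^sub>R h, s j) within (\<lambda>t. (e0 + t *\<^sub>R h, s j)) ` I)"
        by (rule has_derivative_subset[OF der]) (use eQ sQ in auto)
      ultimately have "((\<lambda>t. W (e0 + t *\<^sub>R h) (s j)) has_derivative
          (\<lambda>u. D (e0 + t *\<^sub>R h, s j) (u *\<^sub>R h, 0))) (at t within I)"
        using diff_chain_within[of "\<lambda>t. (e0 + t *\<^sub>R h, s j)" _ t I "\<lambda>(e, e'). W e e'"] by (simp add: o_def)
      moreover have "D (e0 + t *\<^sub>R h, s j) (u *\<^sub>R h, 0) = D (e0 + t *\<^sub>R h, s j) (h, 0) * u" for u
        using blinfun.scaleR_right[of "D (e0 + t *\<^sub>R h, s j)" u "(h, 0)"] by simp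
      ultimately have "((\<lambda>t. W (e0 + t *\<^sub>R h) (s j)) has_field_derivative
          D (e0 + t *\<^sub>R h, s j) (h, 0)) (at t within I)"
        by (simp add: has_field_derivative_def fun_eq_iff)
      then show ?thesis by (rule DERIV_cmult)
    qed
    have nrm: "\<bar>c j * D (e0 + t *\<^sub>R h, s j) (h, 0)\<bar> \<le> c j * (M * norm h)" if "t \<in> I" for j t
    proof -
      have "\<bar>D (e0 + t *\<^sub>R h, s j) (h, 0)\<bar> \<le> norm (D (e0 + t *\<^sub>R h, s j)) * norm (h, 0::'e)"
        using norm_blinfun[of "D (e0 + t *\<^sub>R h, s j)" "(h, 0)"] by simp
      also have "\<dots> \<le> M * norm h"
        using M[of "e0 + t *\<^sub>R h" j] eQ inball[OF that] by (simp add: norm_Pair mult_right_mono)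
      finally show ?thesis
        using c(1)[of j] by (simp add: abs_mult)
    qed
    have 2: "uniformly_convergent_on I (\<lambda>n t. \<Sum>j<n. c j * D (e0 + t *\<^sub>R h, s j) (h, 0))"
      using nrm by (intro Weierstrass_m_test'[where M = "\<lambda>j. c j * (M * norm h)"] summable_mult2 c) auto
    have "((\<lambda>t. \<Psi> (e0 + t *\<^sub>R h)) has_field_derivative (\<Sum>j. c j * D (e0 + 0 *\<^sub>R h, s j) (h, 0))) (at 0)"
      unfolding \<Psi>_def using summ[OF eQ, of 0]
      by (intro has_field_derivative_series'(2)[OF _ 1 2, of 0]) (auto simp: I_def)
    then have "(\<Sum>j. c j * D (e0 + 0 *\<^sub>R h, s j) (h, 0)) = 0"
      by (rule DERIV_local_min[of _ _ _ 1]) (use min eQ in auto)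
    moreover have "summable (\<lambda>j. c j * D (e0, s j) (h, 0))"
      using nrm[of 0] by (intro summable_comparison_test'[OF summable_mult2[OF c(3), of "M * norm h"]]) (auto simp: I_def)
    ultimately show ?thesis by (simp add: sums_iff)
  qed
  have "\<exists>a\<in>Q. \<forall>h\<in>Q. a \<bullet> h = D (e0, s j) (h, 0)" for j
  proof -
    have "linear (\<lambda>h. D (e0, s j) (h, 0))"
      by (intro linear_compose[of "\<lambda>h. (h, 0)" "blinfun_apply (D (e0, s j))", unfolded o_def]
          bounded_linear.linear blinfun.bounded_linear_right bounded_linear_Pair bounded_linear_ident
          bounded_linear_zero)
    then show ?thesis by (rule riesz_subspace[OF _ Q])
  qed
  then obtain a where a: "\<And>j. a j \<in> Q" "\<And>j h. h \<in> Q \<Longrightarrow> a j \<bullet> h = D (e0, s j) (h, 0)" by metis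
  \<comment> \<open>Here \<open>\<gamma> j = \<psi> e0 - \<psi> (s j)\<close> and
    \<open>p = \<phi> e0\<close>. With \<open>v' = 0\<close> in \<open>ineq\<close>, the derivative
    in the second argument is a constant in \<open>v\<close>, possibly growing with
    \<open>j\<close>.\<close>
  have "bounded (range (\<lambda>j. \<psi> e0 - \<psi> (s j)))"
  proof (rule gradient_bound_of_vanishing_mean[of c a "\<phi> e0" _ "\<lambda>j. - D (e0, s j) (0, \<phi> (s j) 0)"])
    show "(\<lambda>j. c j * (a j \<bullet> h)) sums 0" if "h \<in> span (range a)" for h
    proof -
      have "h \<in> Q" using that span_minimal[OF _ Q, of "range a"] a(1) by auto
      then show ?thesis using stationary a(2) by simp
    qed
    obtain M where M: "\<And>j. norm (D (e0, s j)) \<le> M" using dom'[OF e0(1)] by blast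
    have "norm (a j) \<le> M" for j
    proof -
      have "norm (a j) * norm (a j) = D (e0, s j) (a j, 0)"
        using a(2)[OF a(1), of j j] by (simp add: power2_norm_eq_inner[symmetric] power2_eq_square)
      also have "\<dots> \<le> norm (D (e0, s j)) * norm (a j, 0::'e)"
        using norm_blinfun[of "D (e0, s j)" "(a j, 0)"] by simp
      also have "\<dots> \<le> M * norm (a j)" using M by (simp add: norm_Pair mult_right_mono)
      finally show ?thesis using order_trans[OF norm_ge_zero M]
        by (cases "a j = 0") auto
    qed
    then show "bounded (range a)" by (auto simp: bounded_iff)
    show "a j \<bullet> \<phi> e0 v \<le> (\<psi> e0 - \<psi> (s j)) * v + - D (e0, s j) (0, \<phi> (s j) 0)" for j v
      using ineq[OF e0(1) sQ, of j v 0] a(2)[OF \<phi>[OF e0(1)], of j v] by simp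
  qed (use c in auto)
  then obtain C where "\<And>j. \<bar>\<psi> e0 - \<psi> (s j)\<bar> \<le> C" by (auto simp: bounded_iff)
  moreover obtain j where "real j > C + \<bar>\<psi> e0\<bar>" using reals_Archimedean2 by blast
  ultimately have "\<bar>\<psi> e0 - \<psi> (s j)\<bar> < real j - \<bar>\<psi> e0\<bar>" by (meson le_less_trans less_diff_eq)
  then show False using unb[of j] by linarith
qed

section \<open>Nodes and dissipation\<close>

text \<open>A zero row makes \<open>i\<close> an end of no arc, so no walk in the symmetrised graph
  leaves \<open>i\<close>; connectedness, however, leads from \<open>i\<close> to the head of any
  arc. Nonzero rows let the inputs act on every node.\<close>

lemma incidence_row_nonzero:
  fixes G :: "('n::finite, 'm::finite) pre_digraph"
  assumes G: "loopfree_digraph G" "verts G = UNIV" "arcs G = UNIV" "Digraph_Component.connected G"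
  shows "row i (incidence_matrix G) \<noteq> 0"
proof
  interpret loopfree_digraph G by fact
  assume "row i (incidence_matrix G) = 0"
  then have "incidence_matrix G $ i $ k = 0" for k by (simp add: row_def vec_eq_iff)
  then have isolated: "i \<noteq> head G k \<and> i \<noteq> tail G k" for k
    unfolding incidence_matrix_def by (simp split: if_splits) (metis one_neq_zero zero_neq_neg_one)
  have stuck: "a = i \<longrightarrow> b = i" if "(a, b) \<in> rtrancl_on UNIV (parcs (mk_symmetric G))" for a b
    using that by (induction rule: rtrancl_on.induct) (use isolated in \<open>auto simp: parcs_mk_symmetric\<close>)
  \<comment> \<open>The arcs fill a type, hence there is at least one.\<close>
  fix k :: 'm
  have "i \<rightarrow>\<^sup>*\<^bsub>mk_symmetric G\<^esub> head G k"
    using G(4) by (auto simp: Digraph_Component.connected_def strongly_connected_def G(2))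
  then have "head G k = i"
    using stuck by (simp add: reachable_def G(2))
  then show False using isolated by metis
qed

lemma zero_slope_if_bounded_above:
  fixes k C :: real
  assumes "\<And>a. k * a \<le> C"
  shows "k = 0"
proof (rule ccontr)
  assume "k \<noteq> 0"
  then show False using assms[of "(C + 1) / k"] by simp
qed

text \<open>Inputs of arbitrary size along \<open>b\<close> fix the two partial derivatives. With
  zero inputs, \<open>V x x'\<close> then has a time derivative of at most
  \<open>- \<kappa>\<close>, and for \<open>\<kappa> > 0\<close> this nonnegative function would
  become negative in finite time.\<close>

lemma node_decreasing:
  fixes V :: "real \<Rightarrow> real \<Rightarrow> real \<Rightarrow> real" and b :: "'v::real_inner"
  assumes V: "storage_function UNIV V" and b: "b \<noteq> 0"
    and ineq: "\<And>x x' t l l'. t \<ge> 0 \<Longrightarrow>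
      vector_derivative (V x x') (at t within {0..})
        + deriv (\<lambda>s. V s x' t) x * (f x + b \<bullet> l) + deriv (\<lambda>s. V x s t) x' * (f x' + b \<bullet> l')
      \<le> (x *\<^sub>R b - x' *\<^sub>R b) \<bullet> (l - l')"
  shows "(x - x') * (f x - f x') \<le> 0"
proof (rule ccontr)
  define \<kappa> where "\<kappa> = (x - x') * (f x - f x')"
  assume "\<not> ?thesis"
  then have \<kappa>: "\<kappa> > 0" by (simp add: \<kappa>_def)
  define r where "r t = vector_derivative (V x x') (at t within {0..})" for t
  have bb: "b \<bullet> b > 0" using b by simp
  have r: "r t \<le> - \<kappa>" if t: "t \<ge> 0" for t
  proof -
    define p where "p = deriv (\<lambda>s. V s x' t) x"
    define q where "q = deriv (\<lambda>s. V x s t) x'"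
    have le: "r t + p * (f x + b \<bullet> l) + q * (f x' + b \<bullet> l') \<le> (x - x') * (b \<bullet> (l - l'))" for l l'
      using ineq[OF t, of x x' l l'] by (simp add: r_def p_def q_def flip: scaleR_left_diff_distrib)
    \<comment> \<open>With \<open>l\<close> any multiple of \<open>b\<close> and
      \<open>l' = 0\<close>, the inequality bounds a linear function of the scalar from above, so
      its slope is zero. For \<open>q\<close> the roles of \<open>l\<close> and \<open>l'\<close>
      are exchanged.\<close>
    have "(p - (x - x')) * (b \<bullet> b) = 0"
      using le[of "_ *\<^sub>R b" 0]
      by (intro zero_slope_if_bounded_above[of _ "- r t - p * f x - q * f x'"]) (simp add: algebra_simps)
    moreover have "(q + (x - x')) * (b \<bullet> b) = 0"
      using le[of 0 "_ *\<^sub>R b"]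
      by (intro zero_slope_if_bounded_above[of _ "- r t - p * f x - q * f x'"]) (simp add: algebra_simps)
    ultimately have pq: "p = x - x'" "q = - (x - x')" using bb by auto
    show ?thesis using le[of 0 0] unfolding pq \<kappa>_def by (simp add: algebra_simps)
  qed
  obtain D where D: "\<And>p. p \<in> UNIV \<times> UNIV \<times> {0..} \<Longrightarrow>
      ((\<lambda>(x, x', t). V x x' t) has_derivative blinfun_apply (D p)) (at p within UNIV \<times> UNIV \<times> {0..})"
    using V unfolding storage_function_def C1_on_def by blast
  have der: "(V x x' has_vector_derivative r t) (at t within {0..})" if "t \<ge> 0" for t
  proof -
    have "((\<lambda>t. (x, x', t)) has_derivative (\<lambda>t. (0, 0, t))) (at t within {0..})"
      by (auto intro!: derivative_eq_intros)
    moreover have "((\<lambda>(x, x', t). V x x' t) has_derivative blinfun_apply (D (x, x', t)))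
        (at (x, x', t) within (\<lambda>t. (x, x', t)) ` {0..})"
      by (rule has_derivative_subset[OF D]) (use that in auto)
    ultimately have "V x x' differentiable (at t within {0..})"
      using diff_chain_within[of "\<lambda>t. (x, x', t)" _ t "{0..}" "\<lambda>(x, x', t). V x x' t"]
      by (auto simp: o_def intro: differentiableI)
    then show ?thesis unfolding r_def by (simp add: vector_derivative_works)
  qed
  have nonneg: "V x x' t \<ge> 0" if "t \<ge> 0" for t
    using V that by (simp add: storage_function_def)
  \<comment> \<open>Decrease at rate \<open>\<kappa>\<close> during \<open>\<tau>\<close> brings the
    value down to \<open>-1\<close> or below.\<close>
  define \<tau> where "\<tau> = (V x x' 0 + 1) / \<kappa>"
  have \<tau>: "\<tau> > 0" using nonneg[of 0] \<kappa> by (simp add: \<tau>_def)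
  have "\<exists>t\<in>{0<..<\<tau>}. V x x' \<tau> - V x x' 0 = (\<tau> - 0) *\<^sub>R r t"
    by (intro mvt_simple[OF \<tau>] has_derivative_subset[OF der[unfolded has_vector_derivative_def]]) auto
  then obtain t where "0 < t" "V x x' \<tau> - V x x' 0 = \<tau> * r t" by auto
  moreover have "\<tau> * r t \<le> \<tau> * (- \<kappa>)" using r[of t] \<open>0 < t\<close> \<tau> by (intro mult_left_mono) auto
  moreover have "\<tau> * \<kappa> = V x x' 0 + 1" using \<kappa> by (simp add: \<tau>_def)
  ultimately show False using nonneg[of \<tau>] \<tau> by simp
qed

section \<open>Coercive feedback and convergence by dissipation\<close>

lemma diagonal_positive_definite_coercive:
  fixes K :: "real^'m::finite^'m"
  assumes diag: "\<And>i j. i \<noteq> j \<Longrightarrow> K $ i $ j = 0" and pos: "\<And>y. y \<noteq> 0 \<Longrightarrow> y \<bullet> (K *v y) > 0"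
  obtains \<kappa> where "\<kappa> > 0" "\<And>y. \<kappa> * (norm y)\<^sup>2 \<le> y \<bullet> (K *v y)"
proof
  have K: "(K *v y) $ k = K $ k $ k * y $ k" for y k
  proof -
    have "(K *v y) $ k = (\<Sum>j\<in>UNIV. if j = k then K $ k $ k * y $ k else 0)"
      unfolding matrix_vector_mult_def vec_lambda_beta by (rule sum.cong) (use diag in auto)
    then show ?thesis by simp
  qed
  have Kpos: "K $ k $ k > 0" for k
    using pos[of "axis k 1"] by (simp add: inner_axis' K axis_eq_0_iff)
  define \<kappa> where "\<kappa> = Min (range (\<lambda>k. K $ k $ k))"
  show "\<kappa> > 0" using Kpos by (simp add: \<kappa>_def)
  show "\<kappa> * (norm y)\<^sup>2 \<le> y \<bullet> (K *v y)" for y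
    unfolding power2_norm_eq_inner inner_vec_def K sum_distrib_left
  proof (rule sum_mono)
    fix k
    have "\<kappa> \<le> K $ k $ k" by (simp add: \<kappa>_def)
    then show "\<kappa> * (y $ k \<bullet> y $ k) \<le> y $ k \<bullet> (K $ k $ k * y $ k)"
      using mult_right_mono[of \<kappa> "K $ k $ k" "y $ k * y $ k"] by (simp add: mult.left_commute)
  qed
qed

lemma nonincreasing_of_nonpos_derivative:
  fixes E :: "real \<Rightarrow> real"
  assumes der: "\<And>t. t \<ge> 0 \<Longrightarrow> (E has_real_derivative d t) (at t within {0..})"
    and le: "\<And>t. t \<ge> 0 \<Longrightarrow> d t \<le> 0" and st: "0 \<le> s" "s \<le> t"
  shows "E t \<le> E s"
proof (cases "s = t")
  case False
  then have "s < t" using st by simp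
  then have "\<exists>u\<in>{s<..<t}. E t - E s = d u * (t - s)"
    using st
    by (intro mvt_simple has_derivative_subset[OF der[unfolded has_field_derivative_def]]) auto
  then obtain u where u: "s < u" "E t - E s = d u * (t - s)" by auto
  have "d u * (t - s) \<le> 0" using le[of u] u(1) st by (intro mult_nonpos_nonneg) auto
  with u show ?thesis by simp
qed simp

text \<open>A Barbalat-type argument: if \<open>norm (z t) \<ge> e\<close>, the Lipschitz bound
  keeps the norm of \<open>z\<close> at \<open>e / 2\<close> or more for a fixed time, which costs
  \<open>E\<close> a fixed amount. Once \<open>E\<close> is closer than that to its infimum, this
  cannot happen. The mean value theorem takes the place of integrating \<open>d\<close>.\<close>

lemma vanishing_of_lipschitz_dissipation:
  fixes z :: "real \<Rightarrow> 'a::real_normed_vector" and E :: "real \<Rightarrow> real"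
  assumes lip: "\<And>s t. 0 \<le> s \<Longrightarrow> s \<le> t \<Longrightarrow> norm (z t - z s) \<le> C * (t - s)"
    and nonneg: "\<And>t. t \<ge> 0 \<Longrightarrow> E t \<ge> 0"
    and der: "\<And>t. t \<ge> 0 \<Longrightarrow> (E has_real_derivative d t) (at t within {0..})"
    and le: "\<And>t. t \<ge> 0 \<Longrightarrow> d t \<le> - (\<kappa> * (norm (z t))\<^sup>2)" and \<kappa>: "\<kappa> > 0"
  shows "(z \<longlongrightarrow> 0) at_top"
proof -
  have mv: "\<exists>u\<in>{s<..<t}. E t - E s = d u * (t - s)" if "0 \<le> s" "s < t" for s t
    using that
    by (intro mvt_simple[OF that(2)] has_derivative_subset[OF der[unfolded has_field_derivative_def]]) auto
  have "d t \<le> 0" if "t \<ge> 0" for t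
    by (rule order_trans[OF le[OF that]]) (use \<kappa> in simp)
  note anti = nonincreasing_of_nonpos_derivative[of E d, OF der this]
  define L where "L = Inf (E ` {0..})"
  have bdd: "bdd_below (E ` {0..})" using nonneg by (auto intro!: bdd_belowI[of _ 0])
  have L: "L \<le> E t" if "t \<ge> 0" for t using that bdd by (auto simp: L_def intro: cInf_lower)
  \<comment> \<open>Raising the constant to at least 1 makes it a legitimate divisor.\<close>
  define M where "M = max C 1"
  have M: "M > 0" "norm (z t - z s) \<le> M * (t - s)" if "0 \<le> s" "s \<le> t" for s t
    using lip[OF that] mult_right_mono[of C M "t - s"] that by (auto simp: M_def)
  have M0: "M > 0" by (simp add: M_def)
  show ?thesis
  proof (rule tendstoI)
    fix e :: real assume e: "e > 0"
    \<comment> \<open>\<open>h\<close> is a time in which \<open>z\<close> moves by at most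
      \<open>e / 2\<close>; \<open>\<delta>\<close> is the loss of \<open>E\<close> over
      \<open>h\<close> at the dissipation rate that \<open>e / 2\<close> guarantees.\<close>
    define h where "h = e / (2 * M)"
    define \<delta> where "\<delta> = \<kappa> * (e / 2)\<^sup>2 * h"
    have h: "h > 0" and \<delta>: "\<delta> > 0" using e M0 \<kappa> by (auto simp: h_def \<delta>_def)
    obtain t0 where t0: "t0 \<ge> 0" "E t0 < L + \<delta>"
      using cInf_lessD[of "E ` {0..}" "L + \<delta>"] \<delta> by (auto simp: L_def)
    have "norm (z t) < e" if t: "t \<ge> t0" for t
    proof (rule ccontr)
      assume "\<not> ?thesis"
      then have zt: "norm (z t) \<ge> e" by simp
      obtain u where u: "t < u" "u < t + h" "E (t + h) - E t = d u * h"
        using mv[of t "t + h"] t t0 h by auto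
      have "norm (z u - z t) \<le> M * (u - t)" using M(2)[of t u] u t t0 by simp
      also have "\<dots> \<le> M * h" using u M0 by simp
      also have "\<dots> = e / 2" using M0 by (simp add: h_def)
      finally have "norm (z u) \<ge> e / 2"
        using zt norm_triangle_ineq2[of "z t" "z u"] by (simp add: norm_minus_commute)
      then have "(norm (z u))\<^sup>2 \<ge> (e / 2)\<^sup>2" using e by (intro power_mono) auto
      then have "\<kappa> * (norm (z u))\<^sup>2 \<ge> \<kappa> * (e / 2)\<^sup>2" using \<kappa> by (intro mult_left_mono) auto
      then have "d u \<le> - (\<kappa> * (e / 2)\<^sup>2)" using le[of u] u t t0 by simp
      then have "d u * h \<le> - \<delta>" using mult_right_mono[of "d u" "- (\<kappa> * (e / 2)\<^sup>2)" h] h by (simp add: \<delta>_def)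
      then have "E (t + h) \<le> E t - \<delta>" using u(3) by simp
      moreover have "E t \<le> E t0" using anti[of t0 t] t t0 by simp
      moreover have "L \<le> E (t + h)" using L t t0 h by simp
      ultimately show False using t0(2) by simp
    qed
    then show "\<forall>\<^sub>F t in at_top. dist (z t) 0 < e"
      unfolding eventually_at_top_linorder by auto
  qed
qed

section \<open>The interconnection\<close>

lemma inner_matrix_vector: "x \<bullet> (B *v y) = network_output B x \<bullet> (y :: real^'m)"
  for B :: "real^'m^'n"
  by (simp add: network_output_def dot_lmul_matrix transpose_matrix_vector)

lemma network_output_diff: "network_output B (x - y) = network_output B x - network_output B y"
  by (simp add: network_output_def matrix_vector_mult_diff_distrib)

text \<open>The hypotheses in the form in which they act: the node inequality enters as monotonicity
  of \<open>f i\<close>, and the partial derivatives in the edge inequality are values of one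
  continuous derivative \<open>D k\<close> in the directions \<open>(h, 0)\<close> and
  \<open>(0, h)\<close>.\<close>

locale passive_network =
  fixes f :: "'n::finite \<Rightarrow> real \<Rightarrow> real"
    and B :: "real^'m^'n"
    and P :: "real^'p^'n"
    and T :: "'m::finite set"
    and Q :: "'m \<Rightarrow> 'e::euclidean_space set"
    and \<phi> :: "'m \<Rightarrow> 'e \<Rightarrow> real \<Rightarrow> 'e"
    and \<psi> :: "'m \<Rightarrow> 'e \<Rightarrow> real"
    and W :: "'m \<Rightarrow> 'e \<Rightarrow> 'e \<Rightarrow> real"
    and D :: "'m \<Rightarrow> 'e \<times> 'e \<Rightarrow> ('e \<times> 'e) \<Rightarrow>\<^sub>L real"
  assumes decreasing: "\<And>i a b. (a - b) * (f i a - f i b) \<le> 0"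
    and Q: "\<And>k. k \<in> T \<Longrightarrow> subspace (Q k)"
    and \<phi>: "\<And>k e v. k \<in> T \<Longrightarrow> e \<in> Q k \<Longrightarrow> \<phi> k e v \<in> Q k"
    and W_regular: "\<And>k. k \<in> T \<Longrightarrow> regular_storage_function (Q k) (\<lambda>e e' _. W k e e')"
    and D_continuous: "\<And>k. k \<in> T \<Longrightarrow> continuous_on (Q k \<times> Q k) (D k)"
    and D: "\<And>k p. k \<in> T \<Longrightarrow> p \<in> Q k \<times> Q k \<Longrightarrow>
      ((\<lambda>(e, e'). W k e e') has_derivative blinfun_apply (D k p)) (at p within Q k \<times> Q k)"
    and W_passive: "\<And>k e e' v v'. k \<in> T \<Longrightarrow> e \<in> Q k \<Longrightarrow> e' \<in> Q k \<Longrightarrow>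
      D k (e, e') (\<phi> k e v, 0) + D k (e, e') (0, \<phi> k e' v') \<le> (\<psi> k e - \<psi> k e') * (v - v')"
begin

abbreviation trajectory ::
    "(real \<Rightarrow> real^'p) \<Rightarrow> (real \<Rightarrow> (real^'m) \<times> (real^'m)) \<Rightarrow> (real \<Rightarrow> (real^'n) \<times> ('e^'m)) \<Rightarrow> bool" where
  "trajectory w \<mu> \<xi> \<equiv> solution (UNIV \<times> edge_state_space T Q)
     (\<lambda>t s. interconnected_dynamics f B P T \<phi> \<psi> s (\<mu> t) (w t)) \<xi>"

text \<open>The quadratic term has the gradients that the node inequality forces on the functions
  \<open>V i\<close>, and stands in for their sum.\<close>

definition total_storage :: "(real^'n) \<times> ('e^'m) \<Rightarrow> (real^'n) \<times> ('e^'m) \<Rightarrow> real \<Rightarrow> real" where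
  "total_storage s s' t =
     ((fst s - fst s') \<bullet> (fst s - fst s')) / 2 + (\<Sum>k\<in>T. W k (snd s $ k) (snd s' $ k))"

lemma W_nonneg: "k \<in> T \<Longrightarrow> e \<in> Q k \<Longrightarrow> e' \<in> Q k \<Longrightarrow> W k e e' \<ge> 0"
  using W_regular unfolding regular_storage_function_def storage_function_def by force

lemma storage_function_total_storage:
  "storage_function (UNIV \<times> edge_state_space T Q) total_storage"
  unfolding storage_function_def
proof (intro conjI ballI allI impI)
  fix s s' :: "(real^'n) \<times> ('e^'m)" and t :: real
  assume "s \<in> UNIV \<times> edge_state_space T Q" "s' \<in> UNIV \<times> edge_state_space T Q"
  then show "total_storage s s' t \<ge> 0"
    unfolding total_storage_def edge_state_space_def
    by (auto intro!: add_nonneg_nonneg sum_nonneg W_nonneg)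
next
  let ?S = "((UNIV :: (real^'n) set) \<times> edge_state_space T Q) \<times> ((UNIV :: (real^'n) set) \<times> edge_state_space T Q) \<times> {0::real..}"
  have "C1_on ?S (\<lambda>p. ((fst (fst p) - fst (fst (snd p))) \<bullet> (fst (fst p) - fst (fst (snd p)))) / 2)"
    by (intro C1_on_half_norm_square bounded_linear_intros)
  moreover have "C1_on ?S (\<lambda>p. \<Sum>k\<in>T. W k (snd (fst p) $ k) (snd (fst (snd p)) $ k))"
  proof (rule C1_on_sum)
    fix k assume k: "k \<in> T"
    let ?g = "\<lambda>p::((real^'n) \<times> ('e^'m)) \<times> ((real^'n) \<times> ('e^'m)) \<times> real.
      (snd (fst p) $ k, snd (fst (snd p)) $ k)"
    have "C1_on (Q k \<times> Q k) (\<lambda>(e, e'). W k e e')"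
      using D[OF k] D_continuous[OF k] unfolding C1_on_def by blast
    moreover have "bounded_linear ?g"
      by (intro bounded_linear_Pair bounded_linear_compose[OF bounded_linear_vec_nth]
          bounded_linear_intros)
    moreover have "?g ` ?S \<subseteq> Q k \<times> Q k"
      using k by (auto simp: edge_state_space_def)
    ultimately show "C1_on ?S (\<lambda>p. W k (snd (fst p) $ k) (snd (fst (snd p)) $ k))"
      using C1_on_compose_linear[of ?g ?S "Q k \<times> Q k" "\<lambda>(e, e'). W k e e'"] by simp
  qed
  ultimately show "C1_on ?S (\<lambda>(s, s', t). total_storage s s' t)"
    unfolding total_storage_def case_prod_unfold by (rule C1_on_add)
qed

lemma trajectoryD:
  assumes "trajectory w \<mu> \<xi>" "t \<ge> 0"
  shows "((\<lambda>t. fst (\<xi> t)) has_vector_derivative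
      network_dynamics f B P (fst (\<xi> t)) (edge_output T \<psi> (snd (\<xi> t)) + fst (\<mu> t)) (w t)) (at t within {0..})"
    and "k \<in> T \<Longrightarrow> snd (\<xi> t) $ k \<in> Q k"
    and "k \<in> T \<Longrightarrow> ((\<lambda>t. snd (\<xi> t) $ k) has_vector_derivative
      \<phi> k (snd (\<xi> t) $ k) ((- network_output B (fst (\<xi> t)) + snd (\<mu> t)) $ k)) (at t within {0..})"
proof -
  have dyn: "interconnected_dynamics f B P T \<phi> \<psi> (\<xi> t) (\<mu> t) (w t) =
      (network_dynamics f B P (fst (\<xi> t)) (edge_output T \<psi> (snd (\<xi> t)) + fst (\<mu> t)) (w t),
       edge_dynamics T \<phi> (snd (\<xi> t)) (- network_output B (fst (\<xi> t)) + snd (\<mu> t)))"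
    by (simp add: interconnected_dynamics_def Let_def case_prod_unfold)
  have sol: "\<xi> t \<in> UNIV \<times> edge_state_space T Q"
    and der: "(\<xi> has_vector_derivative
      (network_dynamics f B P (fst (\<xi> t)) (edge_output T \<psi> (snd (\<xi> t)) + fst (\<mu> t)) (w t),
       edge_dynamics T \<phi> (snd (\<xi> t)) (- network_output B (fst (\<xi> t)) + snd (\<mu> t)))) (at t within {0..})"
    using assms unfolding solution_def dyn[symmetric] by auto
  show "((\<lambda>t. fst (\<xi> t)) has_vector_derivative
      network_dynamics f B P (fst (\<xi> t)) (edge_output T \<psi> (snd (\<xi> t)) + fst (\<mu> t)) (w t)) (at t within {0..})"
    using bounded_linear.has_vector_derivative[OF bounded_linear_fst der] by simp
  assume k: "k \<in> T"
  show "snd (\<xi> t) $ k \<in> Q k"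
    using sol k by (auto simp: edge_state_space_def mem_Times_iff)
  show "((\<lambda>t. snd (\<xi> t) $ k) has_vector_derivative
      \<phi> k (snd (\<xi> t) $ k) ((- network_output B (fst (\<xi> t)) + snd (\<mu> t)) $ k)) (at t within {0..})"
    using bounded_linear.has_vector_derivative[OF
        bounded_linear_compose[OF bounded_linear_vec_nth bounded_linear_snd] der, of k] k
    by (simp add: edge_dynamics_def)
qed

lemma network_dynamics_diff:
  "network_dynamics f B P x l w - network_dynamics f B P y l' w =
     (\<chi> i. f i (x $ i) - f i (y $ i)) + B *v (l - l')"
  by (simp add: network_dynamics_def vec_eq_iff matrix_vector_mult_diff_distrib)

text \<open>The interconnection preserves power. In terms of output differences \<open>z\<close> and
  \<open>u\<close>, the nodes contribute at most \<open>z \<bullet> u\<close> plus an external term,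
  the edges at most \<open>- (z \<bullet> u)\<close> plus an external term, and the internal
  products cancel.\<close>

lemma total_storage_dissipation:
  assumes tr: "trajectory w \<mu> \<xi>" "trajectory w \<mu>' \<xi>'" and t: "t \<ge> 0"
  obtains d where "((\<lambda>t. total_storage (\<xi> t) (\<xi>' t) t) has_real_derivative d) (at t within {0..})"
    "d \<le> (interconnected_output B T \<psi> (\<xi> t) - interconnected_output B T \<psi> (\<xi>' t)) \<bullet> (\<mu> t - \<mu>' t)"
proof -
  define x x' \<eta> \<eta>' where "x t = fst (\<xi> t)" and "x' t = fst (\<xi>' t)"
    and "\<eta> t = snd (\<xi> t)" and "\<eta>' t = snd (\<xi>' t)" for t
  note X = trajectoryD[OF tr(1) t, folded x_def \<eta>_def] and X' = trajectoryD[OF tr(2) t, folded x'_def \<eta>'_def]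
  define z u where "z = network_output B (x t) - network_output B (x' t)"
    and "u = edge_output T \<psi> (\<eta> t) - edge_output T \<psi> (\<eta>' t)"
  \<comment> \<open>The exogenous term is the same in both motions and cancels from
    \<open>g\<close>.\<close>
  define g where "g = network_dynamics f B P (x t) (edge_output T \<psi> (\<eta> t) + fst (\<mu> t)) (w t)
    - network_dynamics f B P (x' t) (edge_output T \<psi> (\<eta>' t) + fst (\<mu>' t)) (w t)"
  define v v' where "v = - network_output B (x t) + snd (\<mu> t)" and "v' = - network_output B (x' t) + snd (\<mu>' t)"
  define \<delta> where "\<delta> k = D k (\<eta> t $ k, \<eta>' t $ k) (\<phi> k (\<eta> t $ k) (v $ k), 0)
    + D k (\<eta> t $ k, \<eta>' t $ k) (0, \<phi> k (\<eta>' t $ k) (v' $ k))" for k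
  have "((\<lambda>t. x t - x' t) has_vector_derivative g) (at t within {0..})"
    unfolding g_def by (intro has_vector_derivative_diff X(1) X'(1))
  note xd = this[unfolded has_vector_derivative_def]
  have "((\<lambda>t. ((x t - x' t) \<bullet> (x t - x' t)) / 2) has_real_derivative (x t - x' t) \<bullet> g) (at t within {0..})"
    unfolding has_field_derivative_def
    by (rule has_derivative_eq_rhs, (rule xd derivative_eq_intros refl)+) (auto simp: inner_commute)
  moreover have "((\<lambda>t. W k (\<eta> t $ k) (\<eta>' t $ k)) has_real_derivative \<delta> k) (at t within {0..})" if k: "k \<in> T" for k
  proof -
    have "((\<lambda>t. (\<eta> t $ k, \<eta>' t $ k)) has_derivative
        (\<lambda>h. (h *\<^sub>R \<phi> k (\<eta> t $ k) (v $ k), h *\<^sub>R \<phi> k (\<eta>' t $ k) (v' $ k)))) (at t within {0..})"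
      using X(3)[OF k] X'(3)[OF k] unfolding has_vector_derivative_def v_def v'_def
      by (rule has_derivative_Pair)
    moreover have "((\<lambda>(e, e'). W k e e') has_derivative blinfun_apply (D k (\<eta> t $ k, \<eta>' t $ k)))
        (at (\<eta> t $ k, \<eta>' t $ k) within (\<lambda>t. (\<eta> t $ k, \<eta>' t $ k)) ` {0..})"
      by (rule has_derivative_subset[OF D[OF k]])
        (use X(2) X'(2) k trajectoryD(2)[OF tr(1)] trajectoryD(2)[OF tr(2)] in \<open>auto simp: \<eta>_def \<eta>'_def\<close>)
    ultimately have "((\<lambda>t. W k (\<eta> t $ k) (\<eta>' t $ k)) has_derivative
        (\<lambda>h. D k (\<eta> t $ k, \<eta>' t $ k) (h *\<^sub>R \<phi> k (\<eta> t $ k) (v $ k), h *\<^sub>R \<phi> k (\<eta>' t $ k) (v' $ k))))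
        (at t within {0..})"
      using diff_chain_within[of "\<lambda>t. (\<eta> t $ k, \<eta>' t $ k)" _ t "{0..}" "\<lambda>(e, e'). W k e e'"]
      by (simp add: o_def)
    moreover have "D k (\<eta> t $ k, \<eta>' t $ k) (h *\<^sub>R a, h *\<^sub>R b) =
        (D k (\<eta> t $ k, \<eta>' t $ k) (a, 0) + D k (\<eta> t $ k, \<eta>' t $ k) (0, b)) * h" for h a b
      using blinfun.scaleR_right[of "D k (\<eta> t $ k, \<eta>' t $ k)" h "(a, b)"]
        blinfun.add_right[of "D k (\<eta> t $ k, \<eta>' t $ k)" "(a, 0)" "(0, b)"] by (simp add: mult.commute)
    ultimately show ?thesis
      by (simp add: has_field_derivative_def \<delta>_def fun_eq_iff)
  qed
  ultimately have "((\<lambda>t. total_storage (\<xi> t) (\<xi>' t) t) has_real_derivative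
      (x t - x' t) \<bullet> g + (\<Sum>k\<in>T. \<delta> k)) (at t within {0..})"
    unfolding total_storage_def x_def[symmetric] x'_def[symmetric] \<eta>_def[symmetric] \<eta>'_def[symmetric]
    by (intro DERIV_add DERIV_sum)
  moreover have "(x t - x' t) \<bullet> g + (\<Sum>k\<in>T. \<delta> k)
      \<le> (interconnected_output B T \<psi> (\<xi> t) - interconnected_output B T \<psi> (\<xi>' t)) \<bullet> (\<mu> t - \<mu>' t)"
  proof -
    have "(x t - x' t) \<bullet> (\<chi> i. f i (x t $ i) - f i (x' t $ i)) \<le> 0"
      by (auto simp: inner_vec_def intro!: sum_nonpos decreasing)
    moreover have "g = (\<chi> i. f i (x t $ i) - f i (x' t $ i)) + B *v (u + (fst (\<mu> t) - fst (\<mu>' t)))"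
      unfolding g_def network_dynamics_diff by (simp add: u_def algebra_simps)
    ultimately have "(x t - x' t) \<bullet> g \<le> z \<bullet> (u + (fst (\<mu> t) - fst (\<mu>' t)))"
      by (simp add: inner_add_right[of "x t - x' t"] inner_matrix_vector z_def network_output_diff)
    moreover have "(\<Sum>k\<in>T. \<delta> k) \<le> u \<bullet> (v - v')"
    proof -
      have "(\<Sum>k\<in>T. \<delta> k) \<le> (\<Sum>k\<in>T. (\<psi> k (\<eta> t $ k) - \<psi> k (\<eta>' t $ k)) * (v $ k - v' $ k))"
        unfolding \<delta>_def by (intro sum_mono W_passive X(2) X'(2))
      \<comment> \<open>The edge outputs vanish outside \<open>T\<close>, so the sum over
        \<open>T\<close> is the full inner product.\<close>
      also have "\<dots> = u \<bullet> (v - v')"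
        unfolding inner_vec_def u_def edge_output_def
        by (rule sum.mono_neutral_cong_left) auto
      finally show ?thesis .
    qed
    moreover have "v - v' = (snd (\<mu> t) - snd (\<mu>' t)) - z"
      by (simp add: v_def v'_def z_def)
    moreover have "interconnected_output B T \<psi> (\<xi> t) - interconnected_output B T \<psi> (\<xi>' t) = (z, u)"
      by (simp add: interconnected_output_def case_prod_unfold z_def u_def x_def x'_def \<eta>_def \<eta>'_def)
    ultimately show ?thesis
      by (simp add: inner_prod_def inner_add_right inner_diff_right inner_commute)
  qed
  ultimately show ?thesis by (rule that)
qed

lemma incrementally_passive_interconnection:
  "incrementally_passive (UNIV \<times> edge_state_space T Q) \<W>
     (interconnected_dynamics f B P T \<phi> \<psi>) (\<lambda>s _. interconnected_output B T \<psi> s)"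
  unfolding incrementally_passive_def
proof (intro exI[of _ total_storage] conjI ballI allI impI storage_function_total_storage)
  fix w \<mu> \<mu>' \<xi> \<xi>' and t :: real
  assume tr: "trajectory w \<mu> \<xi> \<and> trajectory w \<mu>' \<xi>'" and t: "0 \<le> t"
  show "\<exists>d. ((\<lambda>t. total_storage (\<xi> t) (\<xi>' t) t) has_real_derivative d) (at t within {0..}) \<and>
      d \<le> (interconnected_output B T \<psi> (\<xi> t) - interconnected_output B T \<psi> (\<xi>' t)) \<bullet> (\<mu> t - \<mu>' t)"
    using total_storage_dissipation[OF conjunct1[OF tr] conjunct2[OF tr] t] by blast
qed

end

section \<open>Output feedback\<close>

lemma has_vector_derivative_vec:
  fixes y :: "real \<Rightarrow> 'a::real_normed_vector^'m::finite"
  assumes "\<And>k. ((\<lambda>t. y t $ k) has_vector_derivative d $ k) (at t within S)"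
  shows "(y has_vector_derivative d) (at t within S)"
  unfolding has_vector_derivative_def has_derivative_within
proof
  show "bounded_linear (\<lambda>h. h *\<^sub>R d)" by (rule bounded_linear_scaleR_left)
  show "((\<lambda>u. (1 / norm (u - t)) *\<^sub>R (y u - (y t + (u - t) *\<^sub>R d))) \<longlongrightarrow> 0) (at t within S)"
    using assms unfolding has_vector_derivative_def has_derivative_within
    by (intro vec_tendstoI) simp
qed

lemma bounded_vecI:
  fixes y :: "'b \<Rightarrow> 'a::real_normed_vector^'m::finite"
  assumes "\<And>k. bounded ((\<lambda>t. y t $ k) ` S)"
  shows "bounded (y ` S)"
proof -
  have "\<exists>C. \<forall>t\<in>S. norm (y t $ k) \<le> C" for k
    using assms[of k] by (simp add: bounded_iff)
  then obtain C where C: "\<And>k t. t \<in> S \<Longrightarrow> norm (y t $ k) \<le> C k" by metis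
  have "norm (y t) \<le> (\<Sum>k\<in>UNIV. C k)" if "t \<in> S" for t
    unfolding norm_vec_def
    by (rule order_trans[OF L2_set_le_sum]) (auto intro!: sum_mono C that)
  then show ?thesis by (auto simp: bounded_iff)
qed

text \<open>Monotonicity does the work of continuity: the values lie between \<open>f R\<close> and
  \<open>f (- R)\<close>.\<close>

lemma bounded_compose_antimono:
  fixes f :: "real \<Rightarrow> real"
  assumes "antimono f" "bounded (x ` S)"
  shows "bounded ((\<lambda>t. f (x t)) ` S)"
proof -
  obtain R where R: "\<And>t. t \<in> S \<Longrightarrow> \<bar>x t\<bar> \<le> R" using assms(2) by (auto simp: bounded_iff)
  have "\<bar>f (x t)\<bar> \<le> \<bar>f R\<bar> + \<bar>f (- R)\<bar>" if "t \<in> S" for t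
    using antimonoD[OF assms(1), of "x t" R] antimonoD[OF assms(1), of "- R" "x t"] R[OF that] by linarith
  then show ?thesis by (auto simp: bounded_iff)
qed

context passive_network
begin

lemma antimono_f: "antimono (f i)"
proof (rule antimonoI)
  fix a b :: real assume "a \<le> b"
  then show "f i b \<le> f i a"
    using decreasing[of b a i] by (cases "a = b") (auto simp: mult_le_0_iff)
qed

lemma bounded_edge_output_on:
  assumes "k \<in> T" "S \<subseteq> Q k" "bounded S"
  shows "bounded (\<psi> k ` S)"
  by (rule bounded_edge_output[of "Q k" "D k" "W k" "\<phi> k"])
    (use assms Q D_continuous D W_regular \<phi> W_passive in auto)

text \<open>The reference \<open>\<xi>'\<close> has zero \<open>z\<close> and zero external input,
  so comparison with it turns the supplied power into \<open>- (z t \<bullet> (K *v z t))\<close>.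
  The Lipschitz bound for \<open>z\<close> comes from bounding the difference of the two node
  velocities.\<close>

theorem feedback_output_vanishes:
  assumes tr: "trajectory w (\<lambda>t. (- (K *v network_output B (fst (\<xi> t))), 0)) \<xi>"
    and tr': "trajectory w (\<lambda>_. 0) \<xi>'"
    and bdd': "bounded (\<xi>' ` {0..})"
    and z': "\<And>t. t \<ge> 0 \<Longrightarrow> network_output B (fst (\<xi>' t)) = 0"
    and \<kappa>: "\<kappa> > 0" and K: "\<And>y. \<kappa> * (norm y)\<^sup>2 \<le> y \<bullet> (K *v y)"
  shows "((\<lambda>t. network_output B (fst (\<xi> t))) \<longlongrightarrow> 0) at_top"
proof -
  define z where "z t = network_output B (fst (\<xi> t))" for t
  define E where "E t = total_storage (\<xi> t) (\<xi>' t) t" for t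
  have "\<exists>d. (E has_real_derivative d) (at t within {0..}) \<and> d \<le> - (\<kappa> * (norm (z t))\<^sup>2)"
    if t: "t \<ge> 0" for t
  proof -
    obtain d where d: "(E has_real_derivative d) (at t within {0..})"
      "d \<le> (interconnected_output B T \<psi> (\<xi> t) - interconnected_output B T \<psi> (\<xi>' t)) \<bullet>
        ((- (K *v z t), 0) - 0)"
      using total_storage_dissipation[OF tr tr' t] unfolding E_def z_def by blast
    note d(2)
    also have "(interconnected_output B T \<psi> (\<xi> t) - interconnected_output B T \<psi> (\<xi>' t)) \<bullet>
        ((- (K *v z t), 0) - 0) = - (z t \<bullet> (K *v z t))"
      using z'[OF t] by (simp add: interconnected_output_def case_prod_unfold inner_prod_def z_def)
    also have "\<dots> \<le> - (\<kappa> * (norm (z t))\<^sup>2)" using K by simp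
    finally show ?thesis using d(1) by blast
  qed
  then obtain d where der: "\<And>t. t \<ge> 0 \<Longrightarrow> (E has_real_derivative d t) (at t within {0..})"
    and d: "\<And>t. t \<ge> 0 \<Longrightarrow> d t \<le> - (\<kappa> * (norm (z t))\<^sup>2)" by metis
  have E_le: "E t \<le> E 0" if "t \<ge> 0" for t
  proof (rule nonincreasing_of_nonpos_derivative[OF der])
    show "d u \<le> 0" if "u \<ge> 0" for u
      by (rule order_trans[OF d[OF that]]) (use \<kappa> in simp)
  qed (use that in auto)
  have nonneg: "E t \<ge> 0" if "t \<ge> 0" for t
    using storage_function_total_storage tr tr' that
    unfolding E_def storage_function_def solution_def by blast
  have QT: "snd (\<xi> t) $ k \<in> Q k" "snd (\<xi>' t) $ k \<in> Q k" if "t \<ge> 0" "k \<in> T" for t k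
    using trajectoryD(2)[OF tr that] trajectoryD(2)[OF tr' that] by auto
  have x': "bounded ((\<lambda>t. fst (\<xi>' t)) ` {0..})" and \<eta>': "bounded ((\<lambda>t. snd (\<xi>' t)) ` {0..})"
    using bounded_fst[OF bdd'] bounded_snd[OF bdd'] by (auto simp: image_image)
  \<comment> \<open>All summands of \<open>E\<close> are nonnegative, so each of them is at most
    \<open>E 0\<close>.\<close>
  have Wt: "0 \<le> W k (snd (\<xi> t) $ k) (snd (\<xi>' t) $ k)" if "t \<ge> 0" "k \<in> T" for t k
    using that QT by (intro W_nonneg) auto
  have "norm (fst (\<xi> t) - fst (\<xi>' t)) \<le> sqrt (2 * E 0)" if t: "t \<ge> 0" for t
  proof (rule real_le_rsqrt)
    have "0 \<le> (\<Sum>k\<in>T. W k (snd (\<xi> t) $ k) (snd (\<xi>' t) $ k))"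
      by (intro sum_nonneg Wt t)
    then show "(norm (fst (\<xi> t) - fst (\<xi>' t)))\<^sup>2 \<le> 2 * E 0"
      using E_le[OF t] by (simp add: E_def[of t] total_storage_def power2_norm_eq_inner)
  qed
  then have "bounded ((\<lambda>t. fst (\<xi> t) - fst (\<xi>' t)) ` {0..})" by (auto simp: bounded_iff)
  from bounded_plus_comp[OF this x'] have x: "bounded ((\<lambda>t. fst (\<xi> t)) ` {0..})" by simp
  \<comment> \<open>The reference edge states form the bounded set of second arguments over which
    the sublevel bound is uniform.\<close>
  have \<eta>: "bounded ((\<lambda>t. snd (\<xi> t) $ k) ` {0..})" if k: "k \<in> T" for k
  proof -
    have "(\<lambda>t. snd (\<xi>' t) $ k) ` {0..} \<subseteq> Q k" using QT(2)[OF _ k] by auto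
    then obtain R where R: "\<And>e e'. e \<in> Q k \<Longrightarrow> e' \<in> (\<lambda>t. snd (\<xi>' t) $ k) ` {0..} \<Longrightarrow> W k e e' \<le> E 0 \<Longrightarrow> norm e \<le> R"
      using regular_sublevel_bounded[OF W_regular[OF k] _ bounded_component_cart[OF \<eta>', of k, unfolded image_image], of "E 0"]
      by blast
    have "norm (snd (\<xi> t) $ k) \<le> R" if t: "t \<ge> 0" for t
    proof (rule R)
      have "W k (snd (\<xi> t) $ k) (snd (\<xi>' t) $ k) \<le> (\<Sum>k\<in>T. W k (snd (\<xi> t) $ k) (snd (\<xi>' t) $ k))"
        by (rule member_le_sum[OF k]) (auto intro!: Wt t)
      also have "\<dots> \<le> E t" by (simp add: E_def total_storage_def)
      finally show "W k (snd (\<xi> t) $ k) (snd (\<xi>' t) $ k) \<le> E 0" using E_le[OF t] by simp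
    qed (use t k QT in auto)
    then show ?thesis by (auto simp: bounded_iff)
  qed
  have out_bdd: "bounded ((\<lambda>t. edge_output T \<psi> (y t)) ` {0..})"
    if y: "\<And>k t. k \<in> T \<Longrightarrow> t \<ge> 0 \<Longrightarrow> y t $ k \<in> Q k" "\<And>k. k \<in> T \<Longrightarrow> bounded ((\<lambda>t. y t $ k) ` {0..})" for y
  proof (rule bounded_vecI)
    fix k show "bounded ((\<lambda>t. edge_output T \<psi> (y t) $ k) ` {0..})"
      using bounded_edge_output_on[of k "(\<lambda>t. y t $ k) ` {0..}"] y
      by (cases "k \<in> T") (auto simp: edge_output_def image_image image_subset_iff image_constant_conv)
  qed
  have net: "bounded ((\<lambda>t. \<chi> i. f i (x t $ i)) ` {0..})" if "bounded (x ` {0..})" for x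
  proof (rule bounded_vecI)
    fix i show "bounded ((\<lambda>t. (\<chi> i. f i (x t $ i)) $ i) ` {0..})"
      using bounded_compose_antimono[OF antimono_f bounded_component_cart[OF that, unfolded image_image]]
      by simp
  qed
  \<comment> \<open>\<open>w\<close> cancels from \<open>g\<close>, which is therefore bounded along
    bounded motions even when \<open>w\<close> is not.\<close>
  define g where "g t = network_dynamics f B P (fst (\<xi> t)) (edge_output T \<psi> (snd (\<xi> t)) - K *v z t) (w t)
    - network_dynamics f B P (fst (\<xi>' t)) (edge_output T \<psi> (snd (\<xi>' t))) (w t)" for t
  have g_eq: "g t = ((\<chi> i. f i (fst (\<xi> t) $ i)) - (\<chi> i. f i (fst (\<xi>' t) $ i))) +
      B *v (edge_output T \<psi> (snd (\<xi> t)) - K *v z t - edge_output T \<psi> (snd (\<xi>' t)))" for t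
    unfolding g_def network_dynamics_diff by (simp add: vec_eq_iff)
  have z_bdd: "bounded ((\<lambda>t. K *v z t) ` {0..})"
    using bounded_linear_image[OF bounded_linear_image[OF x matrix_vector_mul_bounded_linear]
        matrix_vector_mul_bounded_linear]
    unfolding z_def network_output_def image_image .
  have "bounded ((\<lambda>t. edge_output T \<psi> (snd (\<xi> t)) - K *v z t - edge_output T \<psi> (snd (\<xi>' t))) ` {0..})"
    by (intro bounded_minus_comp out_bdd \<eta> z_bdd QT bounded_component_cart[OF \<eta>', unfolded image_image])
  from bounded_linear_image[OF this matrix_vector_mul_bounded_linear[of B]]
  have "bounded (g ` {0..})"
    unfolding g_eq image_image by (intro bounded_plus_comp bounded_minus_comp net x x')
  then have "bounded ((\<lambda>t. network_output B (g t)) ` {0..})"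
    unfolding network_output_def
    using bounded_linear_image[OF _ matrix_vector_mul_bounded_linear] by (metis image_image)
  then obtain C where C: "\<And>t. t \<ge> 0 \<Longrightarrow> norm (network_output B (g t)) \<le> C"
    by (auto simp: bounded_iff)
  have lip: "norm (z t - z s) \<le> C * (t - s)" if st: "0 \<le> s" "s \<le> t" for s t
  proof -
    \<comment> \<open>As the reference has zero output, \<open>z\<close> is the output of the
      difference of the node states, whose velocity is \<open>g\<close>; the velocity of
      \<open>fst (\<xi> t)\<close> alone would bring \<open>w\<close> back.\<close>
    have "((\<lambda>t. network_output B (fst (\<xi> t) - fst (\<xi>' t))) has_derivative
        (\<lambda>h. h *\<^sub>R network_output B (g t))) (at t within {0..})" if "t \<in> {0..}" for t
      unfolding network_output_def has_vector_derivative_def[symmetric]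
      using trajectoryD(1)[OF tr] trajectoryD(1)[OF tr'] that
      by (intro bounded_linear.has_vector_derivative[OF matrix_vector_mul_bounded_linear])
        (auto simp: g_def z_def intro!: has_vector_derivative_diff)
    then have "norm (network_output B (fst (\<xi> t) - fst (\<xi>' t)) - network_output B (fst (\<xi> s) - fst (\<xi>' s)))
        \<le> C * norm (t - s)"
    proof (rule differentiable_bound[rotated])
      show "onorm (\<lambda>h. h *\<^sub>R network_output B (g u)) \<le> C" if "u \<in> {0..}" for u
        using C[of u] that by (intro onorm_le) (simp add: mult.commute[of C] mult_left_mono)
    qed (use st in auto)
    then show ?thesis using st z' by (simp add: network_output_diff z_def)
  qed
  show ?thesis
    unfolding z_def[symmetric] by (rule vanishing_of_lipschitz_dissipation[OF lip nonneg der d \<kappa>])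
qed

text \<open>A reference motion closes the loop: zero \<open>z\<close> feeds the edges the input 0
  for which their reference solutions are given, and their outputs are the input of the
  nodes.\<close>

lemma trajectory_of_components:
  assumes x: "\<And>i t. t \<ge> 0 \<Longrightarrow> ((\<lambda>t. x t $ i) has_real_derivative
      f i (x t $ i) + row i B \<bullet> (edge_output T \<psi> (\<eta> t)) + row i P \<bullet> w t) (at t within {0..})"
    and z: "\<And>t. t \<ge> 0 \<Longrightarrow> network_output B (x t) = 0"
    and \<eta>: "\<And>k. k \<in> T \<Longrightarrow> solution (Q k) (\<lambda>_ e. \<phi> k e 0) (\<lambda>t. \<eta> t $ k)"
    and \<eta>0: "\<And>k t. k \<notin> T \<Longrightarrow> \<eta> t $ k = 0"
  shows "trajectory w (\<lambda>_. 0) (\<lambda>t. (x t, \<eta> t))"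
  unfolding solution_def
proof (intro allI impI conjI)
  fix t :: real assume t: "t \<ge> 0"
  show "(x t, \<eta> t) \<in> UNIV \<times> edge_state_space T Q"
    using \<eta> \<eta>0 t by (auto simp: edge_state_space_def solution_def)
  have "(x has_vector_derivative network_dynamics f B P (x t) (edge_output T \<psi> (\<eta> t)) (w t)) (at t within {0..})"
    using x[OF t]
    by (intro has_vector_derivative_vec)
      (simp add: network_dynamics_def matrix_vector_mul_component row_def has_real_derivative_iff_has_vector_derivative
        vec_nth_inverse)
  moreover have "(\<eta> has_vector_derivative edge_dynamics T \<phi> (\<eta> t) 0) (at t within {0..})"
  proof (rule has_vector_derivative_vec)
    fix k show "((\<lambda>t. \<eta> t $ k) has_vector_derivative edge_dynamics T \<phi> (\<eta> t) 0 $ k) (at t within {0..})"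
      using \<eta>[of k] \<eta>0[of k] t by (cases "k \<in> T") (auto simp: edge_dynamics_def solution_def)
  qed
  ultimately show "((\<lambda>t. (x t, \<eta> t)) has_vector_derivative
      interconnected_dynamics f B P T \<phi> \<psi> (x t, \<eta> t) 0 (w t)) (at t within {0..})"
    using z[OF t] has_vector_derivative_Pair
    by (auto simp: interconnected_dynamics_def Let_def zero_prod_def)
qed

end

section \<open>Assembly: from the hypotheses to the passive network and its reference motion\<close>

theorem theorem2:
  fixes G :: "('n::finite, 'm::finite) pre_digraph"
    and B :: "real^'m^'n"
    and P :: "real^'p^'n"
    and S\<^sub>d :: "real^'p^'p"
    and T :: "'m set"
    and f :: "'n \<Rightarrow> real \<Rightarrow> real"
    and Q :: "'m \<Rightarrow> 'e::euclidean_space set"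
    and \<phi> :: "'m \<Rightarrow> 'e \<Rightarrow> real \<Rightarrow> 'e"
    and \<psi> :: "'m \<Rightarrow> 'e \<Rightarrow> real"
    and V :: "'n \<Rightarrow> real \<Rightarrow> real \<Rightarrow> real \<Rightarrow> real"
    and W :: "'m \<Rightarrow> 'e \<Rightarrow> 'e \<Rightarrow> real"
    and lam :: "(real \<Rightarrow> real^'p) \<Rightarrow> real \<Rightarrow> real^'m"
    and Exo :: "(real \<Rightarrow> real^'p) set"
  assumes graph: "loopfree_digraph G" "verts G = UNIV" "arcs G = UNIV"
    and conn: "Digraph_Component.connected G"
    and B: "B = incidence_matrix G"
    \<comment> \<open>\<open>T\<close> is the set of the first \<open>n - 1\<close> edges\<close>
    and T: "card T = CARD('n) - 1"
      "inj_on (\<lambda>k. column k B) T" "independent ((\<lambda>k. column k B) ` T)"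
    and Exo: "Exo = {w. solution UNIV (\<lambda>_ s. S\<^sub>d *v s) w}"
    and Q: "\<And>k. k \<in> T \<Longrightarrow> subspace (Q k)"
    and \<phi>: "\<And>k e v. k \<in> T \<Longrightarrow> e \<in> Q k \<Longrightarrow> \<phi> k e v \<in> Q k"
    and A_regular: "\<And>i. regular_storage_function UNIV (V i)"
    and A: "\<And>i x x' t l l' w. t \<ge> 0 \<Longrightarrow>
      vector_derivative (\<lambda>s. V i x x' s) (at t within {0..})
        + deriv (\<lambda>s. V i s x' t) x * (f i x + row i B \<bullet> l + row i P \<bullet> w)
        + deriv (\<lambda>s. V i x s t) x' * (f i x' + row i B \<bullet> l' + row i P \<bullet> w)
      \<le> (x *\<^sub>R row i B - x' *\<^sub>R row i B) \<bullet> (l - l')"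
    and B_regular: "\<And>k. k \<in> T \<Longrightarrow> regular_storage_function (Q k) (\<lambda>e e' _. W k e e')"
    and B_ineq: "\<And>k e e' v v'. k \<in> T \<Longrightarrow> e \<in> Q k \<Longrightarrow> e' \<in> Q k \<Longrightarrow>
      frechet_derivative (\<lambda>s. W k s e') (at e within Q k) (\<phi> k e v)
        + frechet_derivative (\<lambda>s. W k e s) (at e' within Q k) (\<phi> k e' v')
      \<le> (\<psi> k e - \<psi> k e') * (v - v')"
    and C: "\<And>w. w \<in> Exo \<Longrightarrow>
      (\<forall>t\<ge>0. \<forall>k. k \<notin> T \<longrightarrow> lam w t $ k = 0) \<and>
      (\<exists>xw. (\<forall>i. C1_on {0..} (xw i)) \<and>
        (\<forall>i. \<forall>t\<ge>0. (xw i has_real_derivative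
            f i (xw i t) + row i B \<bullet> lam w t + row i P \<bullet> w t) (at t within {0..})) \<and>
        (\<forall>t\<ge>0. (\<Sum>i\<in>UNIV. xw i t *\<^sub>R row i B) = 0) \<and>
        (\<forall>i. bounded (xw i ` {0..})))"
    and D: "\<And>k w. k \<in> T \<Longrightarrow> w \<in> Exo \<Longrightarrow>
      (\<exists>\<eta>w. solution (Q k) (\<lambda>_ e. \<phi> k e 0) \<eta>w \<and> bounded (\<eta>w ` {0..}) \<and>
        (\<forall>t\<ge>0. lam w t $ k = \<psi> k (\<eta>w t)))"
  shows "incrementally_passive (UNIV \<times> edge_state_space T Q) Exo
           (interconnected_dynamics f B P T \<phi> \<psi>) (\<lambda>s _. interconnected_output B T \<psi> s) \<and>
         (\<forall>K :: real^'m^'m.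
            (\<forall>i j. i \<noteq> j \<longrightarrow> K $ i $ j = 0) \<and> (\<forall>y. y \<noteq> 0 \<longrightarrow> y \<bullet> (K *v y) > 0) \<longrightarrow>
            (\<forall>w x \<eta>. w \<in> Exo \<and>
               solution (UNIV \<times> edge_state_space T Q)
                 (\<lambda>t (x, \<eta>). interconnected_dynamics f B P T \<phi> \<psi> (x, \<eta>)
                               (- (K *v network_output B x), 0) (w t))
                 (\<lambda>t. (x t, \<eta> t)) \<longrightarrow>
               ((\<lambda>t. network_output B (x t)) \<longlongrightarrow> 0) at_top))"
proof -
  note edge_reference = D
  have f_decreasing: "(a - b) * (f i a - f i b) \<le> 0" for i a b
  proof (rule node_decreasing)
    show "storage_function UNIV (V i)" using A_regular by (simp add: regular_storage_function_def)
    show "row i B \<noteq> 0" unfolding B by (rule incidence_row_nonzero[OF graph conn])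
    fix x x' t :: real and l l' :: "real^'m"
    assume "t \<ge> 0"
    \<comment> \<open>The inequality at the exogenous value \<open>0\<close> already carries the
      monotonicity of \<open>f i\<close>.\<close>
    from A[OF this, of i x x' l 0 l']
    show "vector_derivative (V i x x') (at t within {0..})
        + deriv (\<lambda>s. V i s x' t) x * (f i x + row i B \<bullet> l)
        + deriv (\<lambda>s. V i x s t) x' * (f i x' + row i B \<bullet> l')
      \<le> (x *\<^sub>R row i B - x' *\<^sub>R row i B) \<bullet> (l - l')" by simp
  qed
  \<comment> \<open>Smoothness of \<open>W k\<close> is given on a product with the time half-line;
    inserting time 0, a linear map, transfers it to \<open>Q k \<times> Q k\<close>.\<close>
  have "\<exists>D. continuous_on (Q k \<times> Q k) D \<and> (\<forall>p\<in>Q k \<times> Q k.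
      ((\<lambda>(e, e'). W k e e') has_derivative blinfun_apply (D p)) (at p within Q k \<times> Q k))" if k: "k \<in> T" for k
  proof -
    have "C1_on (Q k \<times> Q k \<times> {0..}) (\<lambda>(e, e', t::real). W k e e')"
      using B_regular[OF k] by (simp add: regular_storage_function_def storage_function_def)
    moreover have "bounded_linear (\<lambda>p::'e \<times> 'e. (fst p, snd p, 0::real))"
      by (intro bounded_linear_intros)
    ultimately have "C1_on (Q k \<times> Q k) (\<lambda>(e, e'). W k e e')"
      using C1_on_compose_linear[of "\<lambda>p. (fst p, snd p, 0)" "Q k \<times> Q k" "Q k \<times> Q k \<times> {0..}"
          "\<lambda>(e, e', t::real). W k e e'"]
      by (fastforce simp: case_prod_unfold)
    then show ?thesis unfolding C1_on_def .
  qed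
  then obtain DW where DW_cont: "\<And>k. k \<in> T \<Longrightarrow> continuous_on (Q k \<times> Q k) (DW k)"
    and DW: "\<And>k p. k \<in> T \<Longrightarrow> p \<in> Q k \<times> Q k \<Longrightarrow>
      ((\<lambda>(e, e'). W k e e') has_derivative blinfun_apply (DW k p)) (at p within Q k \<times> Q k)"
    by metis
  interpret passive_network f B P T Q \<phi> \<psi> W DW
  proof
    fix k e e' v v' assume k: "k \<in> T" and e: "e \<in> Q k" "e' \<in> Q k"
    \<comment> \<open>Partial derivatives are the joint derivative along the slices. Since
      \<open>\<phi> k\<close> takes values in \<open>Q k\<close>, \<open>frechet_derivative\<close>
      agrees with them in the directions that occur.\<close>
    have slice1: "((\<lambda>s. W k s e') has_derivative (\<lambda>h. DW k (e, e') (h, 0))) (at e within Q k)"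
    proof -
      have "((\<lambda>s. (s, e')) has_derivative (\<lambda>h. (h, 0))) (at e within Q k)"
        by (auto intro!: derivative_eq_intros)
      moreover have "((\<lambda>(e, e'). W k e e') has_derivative blinfun_apply (DW k (e, e')))
          (at (e, e') within (\<lambda>s. (s, e')) ` Q k)"
        by (rule has_derivative_subset[OF DW[OF k]]) (use e in auto)
      ultimately show ?thesis
        using diff_chain_within[of "\<lambda>s. (s, e')" _ e "Q k" "\<lambda>(e, e'). W k e e'"] by (simp add: o_def)
    qed
    have slice2: "((\<lambda>s. W k e s) has_derivative (\<lambda>h. DW k (e, e') (0, h))) (at e' within Q k)"
    proof -
      have "((\<lambda>s. (e, s)) has_derivative (\<lambda>h. (0, h))) (at e' within Q k)"
        by (auto intro!: derivative_eq_intros)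
      moreover have "((\<lambda>(e, e'). W k e e') has_derivative blinfun_apply (DW k (e, e')))
          (at (e, e') within (\<lambda>s. (e, s)) ` Q k)"
        by (rule has_derivative_subset[OF DW[OF k]]) (use e in auto)
      ultimately show ?thesis
        using diff_chain_within[of "\<lambda>s. (e, s)" _ e' "Q k" "\<lambda>(e, e'). W k e e'"] by (simp add: o_def)
    qed
    show "DW k (e, e') (\<phi> k e v, 0) + DW k (e, e') (0, \<phi> k e' v') \<le> (\<psi> k e - \<psi> k e') * (v - v')"
      using B_ineq[OF k e, of v v']
      by (simp add: frechet_derivative_within_subspace[OF Q[OF k] e(1) \<phi>[OF k e(1)] slice1]
          frechet_derivative_within_subspace[OF Q[OF k] e(2) \<phi>[OF k e(2)] slice2])
  qed (use f_decreasing Q \<phi> B_regular DW_cont DW in auto)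
  show ?thesis
  proof (intro conjI incrementally_passive_interconnection allI impI)
    fix K :: "real^'m^'m" and w x \<eta>
    assume K: "(\<forall>i j. i \<noteq> j \<longrightarrow> K $ i $ j = 0) \<and> (\<forall>y. y \<noteq> 0 \<longrightarrow> y \<bullet> (K *v y) > 0)"
    assume "w \<in> Exo \<and> solution (UNIV \<times> edge_state_space T Q)
        (\<lambda>t (x, \<eta>). interconnected_dynamics f B P T \<phi> \<psi> (x, \<eta>) (- (K *v network_output B x), 0) (w t))
        (\<lambda>t. (x t, \<eta> t))"
    then have w: "w \<in> Exo" and tr: "trajectory w (\<lambda>t. (- (K *v network_output B (x t)), 0)) (\<lambda>t. (x t, \<eta> t))"
      by (auto simp: solution_def)
    obtain xw where lam0: "\<And>t k. t \<ge> 0 \<Longrightarrow> k \<notin> T \<Longrightarrow> lam w t $ k = 0"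
      and xw: "\<And>i t. t \<ge> 0 \<Longrightarrow> (xw i has_real_derivative
          f i (xw i t) + row i B \<bullet> lam w t + row i P \<bullet> w t) (at t within {0..})"
      and zw: "\<And>t. t \<ge> 0 \<Longrightarrow> (\<Sum>i\<in>UNIV. xw i t *\<^sub>R row i B) = 0"
      and xw_bdd: "\<And>i. bounded (xw i ` {0..})"
      using C[OF w] by blast
    obtain \<eta>w where \<eta>w: "\<And>k. k \<in> T \<Longrightarrow> solution (Q k) (\<lambda>_ e. \<phi> k e 0) (\<eta>w k)"
      and \<eta>w_bdd: "\<And>k. k \<in> T \<Longrightarrow> bounded (\<eta>w k ` {0..})"
      and lam_eq: "\<And>k t. k \<in> T \<Longrightarrow> t \<ge> 0 \<Longrightarrow> lam w t $ k = \<psi> k (\<eta>w k t)"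
    proof -
      have "\<forall>k. \<exists>\<eta>. k \<in> T \<longrightarrow> solution (Q k) (\<lambda>_ e. \<phi> k e 0) \<eta> \<and> bounded (\<eta> ` {0..}) \<and>
          (\<forall>t\<ge>0. lam w t $ k = \<psi> k (\<eta> t))"
        using edge_reference[OF _ w] by blast
      from choice[OF this] that show thesis by blast
    qed
    \<comment> \<open>The reference motion: node states from hypothesis \<open>C\<close>, edge
      states from the bounded solutions for input 0, and zero outside \<open>T\<close>.\<close>
    define x' where "x' t = (\<chi> i. xw i t)" for t
    define \<eta>' where "\<eta>' t = (\<chi> k. if k \<in> T then \<eta>w k t else 0)" for t
    \<comment> \<open>The prescribed \<open>lam w\<close> is exactly what the reference edges emit,
      so the reference runs with zero external input.\<close>
    have lam': "edge_output T \<psi> (\<eta>' t) = lam w t" if "t \<ge> 0" for t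
      using lam_eq lam0 that by (simp add: edge_output_def \<eta>'_def vec_eq_iff)
    have z': "network_output B (x' t) = 0" if "t \<ge> 0" for t
    proof -
      have "network_output B (x' t) = (\<Sum>i\<in>UNIV. xw i t *\<^sub>R row i B)"
        by (simp add: network_output_def x'_def vec_eq_iff matrix_vector_mult_def transpose_def row_def mult.commute)
      with zw[OF that] show ?thesis by simp
    qed
    have tr': "trajectory w (\<lambda>_. 0) (\<lambda>t. (x' t, \<eta>' t))"
    proof (rule trajectory_of_components)
      show "((\<lambda>t. x' t $ i) has_real_derivative
          f i (x' t $ i) + row i B \<bullet> edge_output T \<psi> (\<eta>' t) + row i P \<bullet> w t) (at t within {0..})"
        if "t \<ge> 0" for i t
        using xw[OF that] by (simp add: x'_def lam'[OF that])
      show "solution (Q k) (\<lambda>_ e. \<phi> k e 0) (\<lambda>t. \<eta>' t $ k)" if "k \<in> T" for k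
        using \<eta>w[OF that] that by (simp add: \<eta>'_def)
    qed (simp_all add: z' \<eta>'_def)
    have "bounded (x' ` {0..})"
      by (rule bounded_vecI) (simp add: x'_def xw_bdd)
    moreover have "bounded (\<eta>' ` {0..})"
    proof (rule bounded_vecI)
      fix k show "bounded ((\<lambda>t. \<eta>' t $ k) ` {0..})"
        using \<eta>w_bdd[of k] by (cases "k \<in> T") (auto simp: \<eta>'_def image_constant_conv)
    qed
    ultimately have bdd': "bounded ((\<lambda>t. (x' t, \<eta>' t)) ` {0..})"
      by (intro bounded_subset[OF bounded_Times]) auto
    obtain \<kappa> where "\<kappa> > 0" "\<And>y. \<kappa> * (norm y)\<^sup>2 \<le> y \<bullet> (K *v y)"
      using diagonal_positive_definite_coercive K by metis
    then show "((\<lambda>t. network_output B (x t)) \<longlongrightarrow> 0) at_top"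
      using feedback_output_vanishes[where K = K and \<xi> = "\<lambda>t. (x t, \<eta> t)" and \<xi>' = "\<lambda>t. (x' t, \<eta>' t)"] tr tr' bdd' z'
      by simp
  qed
qed

end
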